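(* Consider the dynamic observation model, the regularized objective $\mathcal J$ with minimizer $z^{\mathrm{opt}}$, and the dynamic ensemble Kalman inversion (DEKI) described in the context. Assume the following. (Ergodic data.) $(S_t)_{t\in\mathbb N}$, $S_t\in\mathbb R^{p\times d}$, is a sequence of $\mathcal F_t$-adapted (random) matrices such that there exists a symmetric positive definite and bounded matrix $A\in\mathbb R^{d\times d}$, i.e. $0\preceq A\preceq I$, with the following limiting behaviour: for any $\varepsilon>0$ there is a $\tau_\varepsilon\gtrsim|\log(\varepsilon^{-1})|>0$ such that $$\big\|\mathbb E[S_{t+1+\tau_\varepsilon}^\top S_{t+1+\tau_\varepsilon}\mid\mathcal F_t]-A\big\|\le\varepsilon\quad\text{for all }t\ge1 .$$ Let $(\{z_t^{(j)}\}_{j=1}^J)_{t\in\mathbb N}$ be generated by DEKI with fixed step size $\eta_t=h>0$ and an initial ensemble $\{z_0^{(j)}\}_{j=1}^J$ such that $C_0^{zz}\succ\sigma_l I$ almost surely for some $\sigma_l>0$ with $\lambda=\sigma_l q\in(0,1)$, where $q=2\alpha$. Moreover, let $$h\le\min\Big(\frac{\alpha}{J(A_{\max}+\alpha)^2},\frac{J}{\alpha}\Big)E_0^{-1},\qquad E_0=\frac1J\sum_{j=1}^J\|e_0^{(j)}\|^2 .$$ Then for any $\varepsilon>0$ $$\mathbb E[\mathcal J(\bar z_T)-\mathcal J(z^{\mathrm{opt}})]\in\mathcal O\left(\varepsilon+\frac{1+\tau_\varepsilon\,(1+\log(\tau_\varepsilon)+\log(T))}{T^{\lambda}}\right).$$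 In particular, if one picks $\varepsilon=\frac1T$, resulting in $\tau_\varepsilon=\log(T)$, then $$\mathbb E[\mathcal J(\bar z_T)-\mathcal J(z^{\mathrm{opt}})]\in\mathcal O\left(\frac{\log(T)^2}{T^{\lambda}}\right).$$
   Context: Observation model: on a probability space $(\Omega,\mathcal F,\mathbb P)$, an unknown $z_\ast\in\mathbb R^d$ is observed through $u_t=S_tz_\ast+w_t$, $t\in\mathbb N$, where $S_t\in\mathbb R^{p\times d}$ are (possibly random) matrices and $w_t\sim\mathcal N(0,\Gamma)$ are i.i.d., with $\Gamma\in\mathbb R^{p\times p}$ symmetric positive definite. $\mathcal F_t=\sigma(u_s,\,s\le t)$ is the natural filtration of the observations, and $(w_s)_{s>t}$ is independent of $\mathcal F_t$. Write $A_t=S_t^\top S_t$. The constant $A_{\max}>0$ is a uniform bound: $\|A_t\|\le A_{\max}$ almost surely for all $t$. Objective: for fixed $\alpha>0$ and the limiting matrix $A$, $\mathcal J(z)=\frac12(z-z_\ast)^\top A(z-z_\ast)+\frac{\alpha}{2}\|z\|^2$, so that $\nabla\mathcal J(z)=(A+\alpha I)z-Az_\ast$ and the unique minimizer is $z^{\mathrm{opt}}=(A+\alpha I)^{-1}Az_\ast$. DEKI: for an ensemble of $J$ particles $z_t^{(1)},\dots,z_t^{(J)}\in\mathbb R^d$ and step sizes $\eta_t>0$, $$z_{t+1}^{(j)}=z_t^{(j)}-\eta_tC_t^{zz}\big(S_{t+1}^\top(S_{t+1}z_t^{(j)}-u_{t+1})+\alpha z_t^{(j)}\big),\qquad t\ge0,$$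 with $\bar z_t=\frac1J\sum_{j=1}^Jz_t^{(j)}$, $C_t^{zz}=\frac1J\sum_{j=1}^J(z_t^{(j)}-\bar z_t)(z_t^{(j)}-\bar z_t)^\top$, and ensemble spread $e_t^{(j)}=z_t^{(j)}-\bar z_t$. The particle system is adapted to $(\mathcal F_t)$. Notation: $\preceq,\succ$ denote the Loewner order; $a\gtrsim b$ means $a\ge c\,b$ for some constant $c>0$; $\mathcal O(\cdot)$ means bounded by a constant, not depending on $T$ or $\varepsilon$, times the expression in parentheses.
   Formalization: Two assumptions are added, without which the claim fails: each noise w_{t+1} is independent of F_t together with S_{t+1} (otherwise S_{t+1} may depend on w_{t+1} and bias the limit), and the initial particles have finite second moments (otherwise the expected gap can be infinite). *)

theory Defs
  imports "HOL-Probability.Probability"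
begin

section \<open>Matrices\<close>

definition psd :: "real^'n^'n \<Rightarrow> bool" where
  "psd A \<longleftrightarrow> transpose A = A \<and> (\<forall>x. 0 \<le> x \<bullet> (A *v x))"

definition pos_def :: "real^'n^'n \<Rightarrow> bool" where
  "pos_def A \<longleftrightarrow> transpose A = A \<and> (\<forall>x. x \<noteq> 0 \<longrightarrow> 0 < x \<bullet> (A *v x))"

definition loewner_le :: "real^'n^'n \<Rightarrow> real^'n^'n \<Rightarrow> bool" where
  "loewner_le A B \<longleftrightarrow> psd (B - A)"

definition loewner_less :: "real^'n^'n \<Rightarrow> real^'n^'n \<Rightarrow> bool" where
  "loewner_less A B \<longleftrightarrow> pos_def (B - A)"

text \<open>The spectral norm. The type class norm on \<^typ>\<open>real^'m^'n\<close> is the Frobenius norm instead.\<close>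

definition op_norm :: "real^'m^'n \<Rightarrow> real" where
  "op_norm A = onorm (\<lambda>x. A *v x)"

definition gram :: "real^'m^'n \<Rightarrow> real^'m^'m" where
  "gram S = transpose S ** S"

section \<open>Probability\<close>

definition mv_normal_density :: "real^'p^'p \<Rightarrow> real^'p \<Rightarrow> real" where
  "mv_normal_density \<Gamma> x =
     exp (- (x \<bullet> (matrix_inv \<Gamma> *v x)) / 2) / sqrt ((2 * pi) ^ CARD('p) * det \<Gamma>)"

definition gen_sigma :: "'a set \<Rightarrow> ('i \<Rightarrow> 'a \<Rightarrow> 'b::topological_space) \<Rightarrow> 'i set \<Rightarrow> 'a measure" where
  "gen_sigma \<Omega> X I = sigma \<Omega> (\<Union>i\<in>I. sets (vimage_algebra \<Omega> (X i) borel))"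

text \<open>The \<open>\<sigma>\<close>-algebra generated by \<open>F\<close> together with the single random variable \<open>X\<close>.\<close>

definition extend_sigma :: "'a measure \<Rightarrow> ('a \<Rightarrow> 'b::topological_space) \<Rightarrow> 'a measure" where
  "extend_sigma F X = sigma (space F) (sets F \<union> sets (vimage_algebra (space F) X borel))"

definition matrix_cond_exp :: "'a measure \<Rightarrow> 'a measure \<Rightarrow> ('a \<Rightarrow> real^'m^'n) \<Rightarrow> 'a \<Rightarrow> real^'m^'n" where
  "matrix_cond_exp M F X \<omega> = (\<chi> i k. real_cond_exp M F (\<lambda>\<omega>. X \<omega> $ i $ k) \<omega>)"

section \<open>Observations\<close>

definition observation ::
    "(nat \<Rightarrow> 'a \<Rightarrow> real^'d^'p) \<Rightarrow> real^'d \<Rightarrow> (nat \<Rightarrow> 'a \<Rightarrow> real^'p) \<Rightarrow> nat \<Rightarrow> 'a \<Rightarrow> real^'p" where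
  "observation S zs w t \<omega> = S t \<omega> *v zs + w t \<omega>"

definition natural_filtration ::
    "'a measure \<Rightarrow> (nat \<Rightarrow> 'a \<Rightarrow> 'b::topological_space) \<Rightarrow> nat \<Rightarrow> 'a measure" where
  "natural_filtration M u t = gen_sigma (space M) u {..t}"

text \<open>
  The observation model: Gaussian i.i.d. noise with covariance \<open>\<Gamma>\<close>, with the future noise independent
  of the past observations.  The last clause says that the noise \<open>w (Suc t)\<close> of an observation is
  independent not only of the past but also of the matrix \<open>S (Suc t)\<close> used in that observation.
  It has to be imposed: \<open>S\<close> is only adapted to \<open>\<sigma>(u\<^sub>0, \<dots>, u\<^sub>t)\<close>, which by itself allows
  \<open>S (Suc t)\<close> to be a function of \<open>w (Suc t)\<close>; the observation errors are then biased.
\<close>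

definition observation_model ::
    "'a measure \<Rightarrow> (nat \<Rightarrow> 'a \<Rightarrow> real^'d^'p) \<Rightarrow> real^'d \<Rightarrow> (nat \<Rightarrow> 'a \<Rightarrow> real^'p) \<Rightarrow> real^'p^'p \<Rightarrow> bool" where
  "observation_model M S zs w \<Gamma> \<longleftrightarrow>
     prob_space M \<and>
     pos_def \<Gamma> \<and>
     (\<forall>t. S t \<in> borel_measurable M) \<and>
     (\<forall>t. distributed M lborel (w t) (\<lambda>x. ennreal (mv_normal_density \<Gamma> x))) \<and>
     prob_space.indep_vars M (\<lambda>_. borel) w UNIV \<and>
     (\<forall>t. prob_space.indep_set M
        (sets (natural_filtration M (observation S zs w) t))
        (sets (gen_sigma (space M) w {t<..}))) \<and>
     (\<forall>t. prob_space.indep_set M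
        (sets (extend_sigma (natural_filtration M (observation S zs w) t) (S (Suc t))))
        (sets (vimage_algebra (space M) (w (Suc t)) borel)))"

section \<open>Objective\<close>

definition objective :: "real^'d^'d \<Rightarrow> real \<Rightarrow> real^'d \<Rightarrow> real^'d \<Rightarrow> real" where
  "objective A \<alpha> zs z = 1/2 * ((z - zs) \<bullet> (A *v (z - zs))) + \<alpha>/2 * (norm z)^2"

definition z_opt :: "real^'d^'d \<Rightarrow> real \<Rightarrow> real^'d \<Rightarrow> real^'d" where
  "z_opt A \<alpha> zs = matrix_inv (A + mat \<alpha>) *v (A *v zs)"

lemma z_opt_unique_minimizer:
  assumes A: "psd A" and \<alpha>: "0 < \<alpha>"
  shows "(A + mat \<alpha>) *v z_opt A \<alpha> zs = A *v zs"
    and "objective A \<alpha> zs z - objective A \<alpha> zs (z_opt A \<alpha> zs) =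
           1/2 * ((z - z_opt A \<alpha> zs) \<bullet> ((A + mat \<alpha>) *v (z - z_opt A \<alpha> zs)))"
    and "z \<noteq> z_opt A \<alpha> zs \<Longrightarrow> objective A \<alpha> zs (z_opt A \<alpha> zs) < objective A \<alpha> zs z"
proof -
  let ?B = "A + mat \<alpha>" and ?o = "z_opt A \<alpha> zs"
  have mat: "mat \<alpha> *v x = \<alpha> *\<^sub>R x" for x :: "real^'n"
    by (simp add: vec_eq_iff matrix_vector_mult_def mat_def if_distrib[of "\<lambda>c. c * _"] cong: if_cong)
  have B: "?B *v x = A *v x + \<alpha> *\<^sub>R x" for x
    by (simp add: matrix_vector_mult_add_rdistrib mat)
  have pos: "0 < x \<bullet> (?B *v x)" if "x \<noteq> 0" for x
    using A \<alpha> that by (auto simp: B psd_def inner_add_right intro!: add_nonneg_pos)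
  have "invertible ?B"
    unfolding invertible_left_inverse matrix_left_invertible_ker using pos by force
  then have inv: "?B ** matrix_inv ?B = mat 1"
    unfolding matrix_inv_def invertible_def by (rule someI2_ex) blast
  show eq: "?B *v ?o = A *v zs"
    by (metis z_opt_def matrix_vector_mul_assoc inv matrix_vector_mul_lid)
  have sym: "x \<bullet> (A *v y) = y \<bullet> (A *v x)" for x y
    using A dot_lmul_matrix[of x A y] by (metis psd_def inner_commute transpose_matrix_vector)
  define d where "d = z - ?o"
  have z: "z = ?o + d" by (simp add: d_def)
  have e: "A *v zs = A *v ?o + \<alpha> *\<^sub>R ?o" using eq by (simp add: B)
  have e2: "d \<bullet> (A *v zs) = d \<bullet> (A *v ?o) + \<alpha> * (d \<bullet> ?o)"
    by (simp add: e inner_add_right)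
  show diff: "objective A \<alpha> zs z - objective A \<alpha> zs ?o = 1/2 * ((z - ?o) \<bullet> (?B *v (z - ?o)))"
    unfolding z objective_def
    using e2 by (simp add: B power2_norm_eq_inner inner_add_left inner_add_right inner_diff_left
      inner_diff_right matrix_vector_right_distrib matrix_vector_mult_diff_distrib
      sym[of zs d] sym[of ?o d] sym[of zs ?o] inner_commute[of ?o d] field_simps)
  show "objective A \<alpha> zs ?o < objective A \<alpha> zs z" if "z \<noteq> ?o"
    using pos[of "z - ?o"] that diff by simp
qed

section \<open>Dynamic ensemble Kalman inversion\<close>

text \<open>An ensemble of \<open>J = CARD('j)\<close> particles is a function \<open>'j \<Rightarrow> real^'d\<close>.\<close>

definition ens_mean :: "('j::finite \<Rightarrow> real^'d) \<Rightarrow> real^'d" where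
  "ens_mean Z = (1 / real CARD('j)) *\<^sub>R (\<Sum>j\<in>UNIV. Z j)"

definition ens_spread :: "('j::finite \<Rightarrow> real^'d) \<Rightarrow> 'j \<Rightarrow> real^'d" where
  "ens_spread Z j = Z j - ens_mean Z"

definition ens_cov :: "('j::finite \<Rightarrow> real^'d) \<Rightarrow> real^'d^'d" where
  "ens_cov Z = (\<chi> i k. 1 / real CARD('j) * (\<Sum>j\<in>UNIV. ens_spread Z j $ i * ens_spread Z j $ k))"

definition ens_energy :: "('j::finite \<Rightarrow> real^'d) \<Rightarrow> real" where
  "ens_energy Z = 1 / real CARD('j) * (\<Sum>j\<in>UNIV. (norm (ens_spread Z j))^2)"

definition deki_step ::
    "real \<Rightarrow> real \<Rightarrow> real^'d^'p \<Rightarrow> real^'p \<Rightarrow> ('j::finite \<Rightarrow> real^'d) \<Rightarrow> 'j \<Rightarrow> real^'d" where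
  "deki_step \<alpha> \<eta> S u Z j =
     Z j - \<eta> *\<^sub>R (ens_cov Z *v (transpose S *v (S *v Z j - u) + \<alpha> *\<^sub>R Z j))"

definition is_deki ::
    "'a measure \<Rightarrow> real \<Rightarrow> (nat \<Rightarrow> real) \<Rightarrow> (nat \<Rightarrow> 'a \<Rightarrow> real^'d^'p) \<Rightarrow> (nat \<Rightarrow> 'a \<Rightarrow> real^'p)
      \<Rightarrow> (nat \<Rightarrow> 'a \<Rightarrow> 'j::finite \<Rightarrow> real^'d) \<Rightarrow> bool" where
  "is_deki M \<alpha> \<eta> S u z \<longleftrightarrow>
     (\<forall>t. \<forall>\<omega>\<in>space M. z (Suc t) \<omega> = deki_step \<alpha> (\<eta> t) (S (Suc t) \<omega>) (u (Suc t) \<omega>) (z t \<omega>)) \<and>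
     (\<forall>t j. (\<lambda>\<omega>. z t \<omega> j) \<in> borel_measurable (natural_filtration M u t))"

section \<open>Ergodic data\<close>

text \<open>
  \<open>\<tau> \<epsilon>\<close> is a chosen delay for each accuracy \<open>\<epsilon>\<close>; it has to grow at least like \<open>|ln (1 / \<epsilon>)|\<close>, with a
  constant \<open>c\<close> that does not depend on \<open>\<epsilon>\<close>.  Positivity of \<open>\<tau> \<epsilon>\<close> is stated separately because the
  logarithm vanishes at \<open>\<epsilon> = 1\<close>.
\<close>

definition ergodic_data ::
    "'a measure \<Rightarrow> (nat \<Rightarrow> 'a measure) \<Rightarrow> (nat \<Rightarrow> 'a \<Rightarrow> real^'d^'p) \<Rightarrow> real^'d^'d \<Rightarrow> (real \<Rightarrow> nat) \<Rightarrow> bool" where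
  "ergodic_data M F S A \<tau> \<longleftrightarrow>
     (\<forall>t. S t \<in> borel_measurable (F t)) \<and>
     pos_def A \<and> loewner_le 0 A \<and> loewner_le A (mat 1) \<and>
     (\<exists>c>0. \<forall>\<epsilon>>0. c * \<bar>ln (1 / \<epsilon>)\<bar> \<le> real (\<tau> \<epsilon>)) \<and>
     (\<forall>\<epsilon>>0. 0 < \<tau> \<epsilon> \<and>
        (\<forall>t\<ge>1. AE \<omega> in M.
           op_norm (matrix_cond_exp M (F t) (\<lambda>\<omega>. gram (S (t + 1 + \<tau> \<epsilon>) \<omega>)) \<omega> - A) \<le> \<epsilon>))"

end

theory Submission
  imports Defs
begin

text \<open>
  Let \<open>x\<^sub>t\<close> be the ensemble mean minus the minimizer, \<open>C\<^sub>t\<close> the ensemble covariance, and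
  \<open>B\<^sub>t = S\<^sup>T S + \<alpha> I\<close> with \<open>S\<close> the matrix of the observation used in step \<open>t\<close>.  The dynamics read
  \<open>x' = x - h C (B x - g)\<close> and \<open>C' = P C P\<^sup>T\<close> with \<open>P = I - h C B\<close>, where
  \<open>g = S\<^sup>T w - (S\<^sup>T S - A) v\<close> and \<open>v\<close> is the minimizer minus the true parameter.  The force \<open>g\<close> consists
  of centred noise and of a bias that is small only in conditional mean and only after a delay.

  The matrices \<open>B\<^sub>t\<close> vary and do not commute with \<open>C\<^sub>t\<close>, so \<open>norm x\<close> itself need not decrease.  But the
  same \<open>P\<close> transports \<open>x\<close> and \<open>C\<close>, hence the energy \<open>V = x \<bullet> C\<^sup>-\<^sup>1 x\<close> is conserved while
  \<open>g = 0\<close>, whatever the \<open>B\<^sub>t\<close> are.  The bound on the step size makes \<open>h C B\<close> a strict contraction and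
  yields \<open>C' \<le> C - h \<alpha> C\<^sup>2\<close>. Along a unit vector this is a scalar Riccati inequality, which gives
  \<open>C\<^sub>t \<le> 1 / (h \<alpha> (t + 1))\<close>, so that \<open>h \<alpha> (t + 1) (norm x\<^sub>t)\<^sup>2 \<le> V\<^sub>t\<close>.  Everything reduces to showing that the expectation of \<open>V\<^sub>T\<close> grows
  slowly (\<open>energy_bound\<close> in \<open>riccati_recursion\<close>, a pathwise statement).

  A step changes \<open>V\<close> by \<open>2 h x \<bullet> g\<close> up to terms of order \<open>1 / (t + 1)\<close>, whose sum is of order
  \<open>log T\<close>.  In expectation the noise drops out of \<open>x \<bullet> g\<close>, since it is independent of \<open>x\<^sub>t\<close> and \<open>S\<close>
  jointly.  In the bias term \<open>x\<^sub>t\<close> is replaced by \<open>x\<^sub>r\<close> with \<open>r = t - \<tau>\<close>: as increments of \<open>x\<close> are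
  of order \<open>1 / (t + 1)\<close>, this costs \<open>\<tau> / (r + 1)\<close>, and conditioning on the observations up to \<open>r\<close>
  leaves a multiple of \<open>\<epsilon>\<close>.  Summation gives (\<open>mean_square_rate\<close> in \<open>error_process\<close>) that the mean of
  \<open>(norm x\<^sub>T)\<^sup>2\<close> is at most a constant times \<open>\<epsilon> + \<tau> (1 + log T) / T\<close>.  The excess of the objective is a
  quadratic form in \<open>x\<^sub>T\<close>, and \<open>T\<close> dominates \<open>T\<close> to the power \<open>lam\<close> because \<open>lam < 1\<close>.
\<close>

section \<open>Riccati recursions and the energy of a driven error\<close>

text \<open>
  The Cauchy--Schwarz inequality for the semi-definite form of \<open>L\<close>, applied to \<open>y\<close> and \<open>L y\<close>. It
  turns upper bounds on a quadratic form into operator bounds without any spectral decomposition.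
\<close>

lemma psd_operator_norm_bound:
  fixes L :: "'v::euclidean_space \<Rightarrow> 'v"
  assumes linear: "linear L"
    and symmetric: "\<And>p y. L p \<bullet> y = p \<bullet> L y"
    and psd: "\<And>y. 0 \<le> y \<bullet> L y"
    and upper: "\<And>p. p \<bullet> L p \<le> k * (norm p)\<^sup>2"
  shows "(norm (L y))\<^sup>2 \<le> k * (y \<bullet> L y)" and "norm (L y) \<le> k * norm y"
proof -
  obtain b0 :: 'v where "b0 \<in> Basis" using nonempty_Basis by blast
  then have k: "0 \<le> k" using upper[of b0] psd[of b0] by simp
  define p where "p = L y"
  have np: "(norm p)\<^sup>2 = p \<bullet> p" by (rule power2_norm_eq_inner)
  \<comment> \<open>The Cauchy--Schwarz inequality of the form, in the shape of the discriminant test.\<close>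
  have disc: "0 \<le> c\<^sup>2 * (y \<bullet> L y) - 2 * c * (norm p)\<^sup>2 + p \<bullet> L p" for c
  proof -
    have "y \<bullet> L p = p \<bullet> p" by (metis symmetric p_def)
    then have "(c *\<^sub>R y - p) \<bullet> L (c *\<^sub>R y - p) = c\<^sup>2 * (y \<bullet> L y) - 2 * c * (p \<bullet> p) + p \<bullet> L p"
      by (simp add: p_def[symmetric] linear_diff[OF linear] linear_scale[OF linear]
        inner_diff_left inner_diff_right power2_eq_square algebra_simps inner_commute)
    then show ?thesis using psd[of "c *\<^sub>R y - p"] by (simp add: np)
  qed
  show 1: "(norm (L y))\<^sup>2 \<le> k * (y \<bullet> L y)"
  proof (cases "k = 0")
    case True
    have z: "p \<bullet> L p = 0" "y \<bullet> L y = 0"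
      using upper[of p] psd[of p] upper[of y] psd[of y] True by auto
    show ?thesis using disc[of 1] z by (simp add: True p_def)
  next
    case False
    then have "0 < k" using k by simp
    have "k * (norm p)\<^sup>2 \<le> k * (k * (y \<bullet> L y))"
      using disc[of k] upper[of p] by (simp add: power2_eq_square algebra_simps)
    then show ?thesis using \<open>0 < k\<close> by (simp add: p_def)
  qed
  have "(norm (L y))\<^sup>2 \<le> k * (k * (norm y)\<^sup>2)"
    using 1 mult_left_mono[OF upper[of y] k] by linarith
  then have "(norm (L y))\<^sup>2 \<le> (k * norm y)\<^sup>2"
    by (simp only: power2_eq_square mult.assoc mult.left_commute)
  then show "norm (L y) \<le> k * norm y" by (rule power2_le_imp_le) (use k in simp)
qed

text \<open>
  The discrete analogue of \<open>s' = - s\<^sup>2\<close>: the inequality implies \<open>s' \<le> s / (1 + s)\<close>, that is, the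
  reciprocal increases by at least one as long as \<open>s'\<close> is positive.
\<close>

lemma riccati_scalar_step:
  fixes s s' k :: real
  assumes "0 \<le> s" "0 < n" "s * n \<le> 1" "s' \<le> s - s\<^sup>2"
  shows "s' * (n + 1) \<le> 1"
proof -
  have "s' * (1 + s) \<le> (s - s\<^sup>2) * (1 + s)" using assms by (intro mult_right_mono) auto
  also have "\<dots> \<le> s"
    using assms by (simp add: algebra_simps power2_eq_square)
  finally have a: "s' * (1 + s) \<le> s" .
  show ?thesis
  proof (cases "s' \<le> 0")
    case True then show ?thesis using assms by (smt (verit) mult_nonpos_nonneg)
  next
    case False
    have "s' \<le> s * (1 - s')" using a by (simp add: algebra_simps)
    moreover have "s' \<le> 1"
    proof -
      have "s - s\<^sup>2 \<le> 1" using zero_le_power2[of "s - 1"] assms(1) by (simp add: power2_eq_square algebra_simps)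
      then show ?thesis using assms by linarith
    qed
    ultimately have "s' * n \<le> (s * n) * (1 - s')"
      using assms(2) by (smt (verit) mult.assoc mult.commute mult_right_mono)
    also have "\<dots> \<le> 1 * (1 - s')" using assms \<open>s' \<le> 1\<close> by (intro mult_right_mono) auto
    finally show ?thesis by (simp add: algebra_simps)
  qed
qed

text \<open>
  Coefficient of the terms of order \<open>1 / (t + 1)\<close> in the growth of the energy. The factor
  \<open>1 - \<alpha> / b\<close> is the lower bound for \<open>I - h B C\<close> that the step size guarantees.
\<close>

definition energy_growth :: "real \<Rightarrow> real \<Rightarrow> real \<Rightarrow> real" where
  "energy_growth h \<alpha> b = 2 * h * (b / (\<alpha> * (1 - \<alpha> / b))) + h / (\<alpha> * (1 - \<alpha> / b)\<^sup>2)"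

lemma energy_growth_nonneg:
  assumes "0 < h" "0 < \<alpha>" "\<alpha> < b"
  shows "0 \<le> energy_growth h \<alpha> b"
proof -
  have "0 < 1 - \<alpha> / b" "0 < b" using assms by auto
  then show ?thesis unfolding energy_growth_def using assms
    by (intro add_nonneg_nonneg mult_nonneg_nonneg divide_nonneg_nonneg zero_le_power2) linarith+
qed

text \<open>
  One path of the covariance recursion. The operator \<open>B t\<close> belongs to the step from \<open>t\<close> to \<open>t + 1\<close>,
  and \<open>C\<close> evolves by \<open>C' = P C P\<^sup>T\<close> with \<open>P = I - h C B\<close>. By symmetry \<open>P C = C P\<^sup>T\<close>, so this is the
  same as \<open>C' = C P\<^sup>T P\<^sup>T\<close>, the form used here.
\<close>

locale riccati_recursion =
  fixes C B :: "nat \<Rightarrow> 'v::euclidean_space \<Rightarrow> 'v" and h \<alpha> b :: real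
  assumes linear_C: "linear (C t)"
    and symmetric_C: "C t p \<bullet> y = p \<bullet> C t y"
    and psd_C: "0 \<le> y \<bullet> C t y"
    and linear_B: "linear (B t)"
    and symmetric_B: "B t p \<bullet> y = p \<bullet> B t y"
    and B_lower: "\<alpha> * (norm y)\<^sup>2 \<le> y \<bullet> B t y"
    and B_upper: "norm (B t y) \<le> b * norm y"
    and h_pos: "0 < h" and \<alpha>_pos: "0 < \<alpha>" and \<alpha>_less: "\<alpha> < b"
    and recursion: "C (Suc t) y =
      C t (y - h *\<^sub>R B t (C t y) - h *\<^sub>R B t (C t (y - h *\<^sub>R B t (C t y))))"
    and initial: "h * (y \<bullet> C 0 y) \<le> \<alpha> / b\<^sup>2 * (norm y)\<^sup>2"
begin

text \<open>
  The adjoint \<open>P\<^sup>T = I - h B C\<close> of the propagator.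
\<close>

definition Q :: "nat \<Rightarrow> 'v \<Rightarrow> 'v" where
  "Q t y = y - h *\<^sub>R B t (C t y)"

lemma C_Suc: "C (Suc t) y = C t (Q t (Q t y))"
  by (simp add: recursion Q_def)

lemma linear_Q: "linear (Q t)"
  unfolding Q_def
  by (intro linear_compose_sub linear_ident linear_compose_scale_right
        linear_compose[OF linear_C linear_B, unfolded o_def])

lemma C_Q: "C t (Q t y) \<bullet> p = C t y \<bullet> Q t p"
  by (simp add: Q_def linear_diff[OF linear_C] linear_scale[OF linear_C] inner_diff_left
      inner_diff_right symmetric_C symmetric_B)

text \<open>
  With \<open>p = C y\<close>, expanding gives \<open>y \<bullet> C' y = y \<bullet> C y - 2 h p \<bullet> B p + h\<^sup>2 B p \<bullet> C B p\<close>. The bound on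
  \<open>h C\<close> makes the quadratic correction at most half of the linear decrease.
\<close>

lemma quadratic_step:
  assumes "\<And>p. h * (p \<bullet> C t p) \<le> \<alpha> / b\<^sup>2 * (norm p)\<^sup>2"
  shows "y \<bullet> C (Suc t) y \<le> y \<bullet> C t y - h * \<alpha> * (norm (C t y))\<^sup>2"
proof -
  define p where "p = C t y"
  have "y \<bullet> C (Suc t) y = C t (Q t y) \<bullet> Q t y"
    by (simp add: C_Suc C_Q inner_commute[of y])
  also have "\<dots> = y \<bullet> C t y - 2 * h * (p \<bullet> B t p) + h * (h * (B t p \<bullet> C t (B t p)))"
    using symmetric_C[of t "B t p" y] symmetric_C[of t y "B t p"]
    by (simp add: Q_def p_def[symmetric] linear_diff[OF linear_C] linear_scale[OF linear_C]
        inner_diff_left inner_diff_right algebra_simps inner_commute)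
  also have "h * (h * (B t p \<bullet> C t (B t p))) \<le> h * (p \<bullet> B t p)"
  proof (rule mult_left_mono)
    have "h * (B t p \<bullet> C t (B t p)) \<le> \<alpha> / b\<^sup>2 * (norm (B t p))\<^sup>2" by (rule assms)
    also have "\<dots> \<le> \<alpha> / b\<^sup>2 * (b * norm p)\<^sup>2"
      using B_upper[of t p] \<alpha>_pos by (intro mult_left_mono power_mono) auto
    also have "\<dots> = \<alpha> * (norm p)\<^sup>2"
      using \<alpha>_pos \<alpha>_less by (simp add: power_mult_distrib)
    also have "\<dots> \<le> p \<bullet> B t p" by (rule B_lower)
    finally show "h * (B t p \<bullet> C t (B t p)) \<le> p \<bullet> B t p" .
  qed (use h_pos in simp)
  finally have "y \<bullet> C (Suc t) y \<le> y \<bullet> C t y - h * (p \<bullet> B t p)" by simp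
  moreover have "h * (\<alpha> * (norm p)\<^sup>2) \<le> h * (p \<bullet> B t p)"
    using B_lower[of p t] h_pos by simp
  ultimately show ?thesis by (simp add: p_def)
qed

lemma quadratic_bound: "h * (y \<bullet> C t y) \<le> \<alpha> / b\<^sup>2 * (norm y)\<^sup>2"
proof (induction t arbitrary: y)
  case (Suc t)
  have "0 \<le> h * \<alpha> * (norm (C t y))\<^sup>2" using h_pos \<alpha>_pos by simp
  then have "y \<bullet> C (Suc t) y \<le> y \<bullet> C t y" using quadratic_step[OF Suc.IH, of y] by linarith
  then show ?case using Suc.IH[of y] h_pos by (meson mult_left_mono less_imp_le order_trans)
qed (rule initial)

text \<open>
  The Riccati inequality closes along a fixed unit vector \<open>y\<close>, because
  \<open>(y \<bullet> C y)\<^sup>2 \<le> (norm (C y))\<^sup>2\<close>; no eigenvector has to be followed through time.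
\<close>

lemma quadratic_decay: "h * \<alpha> * (real t + 1) * (y \<bullet> C t y) \<le> (norm y)\<^sup>2"
proof -
  have unit: "h * \<alpha> * (y \<bullet> C t y) * (real t + 1) \<le> 1" if y: "norm y = 1" for y
  proof (induction t)
    case 0
    have "\<alpha> * (h * (y \<bullet> C 0 y)) \<le> \<alpha> * (\<alpha> / b\<^sup>2)"
      using initial[of y] y \<alpha>_pos by (intro mult_left_mono) auto
    also have "\<dots> \<le> 1"
      using \<alpha>_pos \<alpha>_less by (simp add: field_simps power2_eq_square mult_mono)
    finally show ?case by (simp add: mult_ac)
  next
    case (Suc t)
    let ?s = "h * \<alpha> * (y \<bullet> C t y)"
    have "(y \<bullet> C t y)\<^sup>2 \<le> (norm (C t y))\<^sup>2"
      using Cauchy_Schwarz_ineq2[of y "C t y"] y by (metis abs_le_square_iff abs_norm_cancel mult_1)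
    then have "(h * \<alpha>)\<^sup>2 * (y \<bullet> C t y)\<^sup>2 \<le> (h * \<alpha>)\<^sup>2 * (norm (C t y))\<^sup>2"
      by (intro mult_left_mono) auto
    moreover have "h * \<alpha> * (y \<bullet> C (Suc t) y) \<le> h * \<alpha> * (y \<bullet> C t y - h * \<alpha> * (norm (C t y))\<^sup>2)"
      using quadratic_step[OF quadratic_bound, of y t] h_pos \<alpha>_pos by (intro mult_left_mono) auto
    ultimately have "h * \<alpha> * (y \<bullet> C (Suc t) y) \<le> ?s - ?s\<^sup>2"
      by (simp add: power2_eq_square algebra_simps)
    then have "h * \<alpha> * (y \<bullet> C (Suc t) y) * ((real t + 1) + 1) \<le> 1"
      using Suc.IH h_pos \<alpha>_pos psd_C by (intro riccati_scalar_step[of ?s "real t + 1"]) auto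
    then show ?case by (simp add: ac_simps)
  qed
  show ?thesis
  proof (cases "y = 0")
    case False
    define e where "e = y /\<^sub>R norm y"
    have "norm e = 1" and y: "y = norm y *\<^sub>R e" using False by (auto simp: e_def)
    have "y \<bullet> C t y = (norm y)\<^sup>2 * (e \<bullet> C t e)"
      by (subst (1 2) y) (simp only: linear_scale[OF linear_C] inner_scaleR_left inner_scaleR_right power2_eq_square mult.assoc)
    then have "h * \<alpha> * (real t + 1) * (y \<bullet> C t y) = (norm y)\<^sup>2 * (h * \<alpha> * (e \<bullet> C t e) * (real t + 1))"
      by simp
    also have "\<dots> \<le> (norm y)\<^sup>2 * 1" by (intro mult_left_mono unit \<open>norm e = 1\<close>) auto
    finally show ?thesis by simp
  qed simp
qed

lemma C_decay:
  "h * \<alpha> * (real t + 1) * (norm (C t y))\<^sup>2 \<le> y \<bullet> C t y"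
  "h * norm (C t y) \<le> norm y / (\<alpha> * (real t + 1))"
proof -
  have pos: "0 < h * \<alpha> * (real t + 1)" using h_pos \<alpha>_pos by simp
  have q: "p \<bullet> C t p \<le> 1 / (h * \<alpha> * (real t + 1)) * (norm p)\<^sup>2" for p
    using quadratic_decay[of t p] pos by (simp add: pos_le_divide_eq mult_ac)
  show "h * \<alpha> * (real t + 1) * (norm (C t y))\<^sup>2 \<le> y \<bullet> C t y"
    using psd_operator_norm_bound(1)[OF linear_C symmetric_C psd_C q, of y] pos by (simp add: pos_le_divide_eq mult_ac)
  have "h * norm (C t y) \<le> h * (1 / (h * \<alpha> * (real t + 1)) * norm y)"
    using psd_operator_norm_bound(2)[OF linear_C symmetric_C psd_C q, of y] h_pos by (intro mult_left_mono) auto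
  also have "\<dots> = norm y / (\<alpha> * (real t + 1))" using h_pos by simp
  finally show "h * norm (C t y) \<le> norm y / (\<alpha> * (real t + 1))" .
qed

lemma Q_lower: "(1 - \<alpha> / b) * norm y \<le> norm (Q t y)"
proof -
  define k where "k = \<alpha> / b\<^sup>2"
  have k: "0 < k" "b * k = \<alpha> / b" using \<alpha>_pos \<alpha>_less by (auto simp: k_def power2_eq_square)
  have q: "p \<bullet> C t p \<le> k / h * (norm p)\<^sup>2" for p
    using quadratic_bound[of p t] h_pos unfolding k_def[symmetric]
    by (simp add: pos_le_divide_eq mult.commute)
  have "norm (C t y) \<le> k / h * norm y" by (rule psd_operator_norm_bound(2)[OF linear_C symmetric_C psd_C q])
  then have 1: "h * norm (C t y) \<le> k * norm y"
    using h_pos by (simp add: pos_le_divide_eq mult.commute)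
  have "norm (h *\<^sub>R B t (C t y)) = h * norm (B t (C t y))" using h_pos by simp
  also have "\<dots> \<le> h * (b * norm (C t y))" using h_pos by (intro mult_left_mono B_upper) linarith
  also have "\<dots> = b * (h * norm (C t y))" by (rule mult.left_commute)
  also have "\<dots> \<le> b * (k * norm y)" using \<alpha>_pos \<alpha>_less by (intro mult_left_mono[OF 1]) linarith
  also have "\<dots> = \<alpha> / b * norm y" by (simp only: mult.assoc[symmetric] k(2))
  finally have "norm (h *\<^sub>R B t (C t y)) \<le> \<alpha> / b * norm y" .
  moreover have "norm y - norm (h *\<^sub>R B t (C t y)) \<le> norm (Q t y)"
    unfolding Q_def by (rule norm_triangle_ineq2)
  ultimately show ?thesis by (simp only: left_diff_distrib mult_1_left)
qed

lemma surj_Q: "surj (Q t)"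
proof (rule linear_inj_imp_surj[OF linear_Q])
  have "y = 0" if "Q t y = 0" for y
  proof -
    have "0 < 1 - \<alpha> / b" using \<alpha>_pos \<alpha>_less by simp
    moreover have "(1 - \<alpha> / b) * norm y \<le> 0" using Q_lower[of y t] by (simp only: that norm_zero)
    ultimately show ?thesis by (metis mult_le_0_iff norm_le_zero_iff not_less)
  qed
  then show "inj (Q t)" using linear_injective_0[OF linear_Q] by blast
qed

abbreviation "growth \<equiv> energy_growth h \<alpha> b"

text \<open>
  Write \<open>x = C y\<close>, so that the energy is \<open>x \<bullet> y\<close>; carrying the preimage \<open>y\<close> along avoids inverting
  \<open>C\<close>. If \<open>Q r = g\<close> and \<open>Q y' = y + h r\<close>, then \<open>x' = C' y'\<close> and the new energy is the form of \<open>C\<close> at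
  \<open>y + h r\<close>, which is \<open>x \<bullet> y + 2 h x \<bullet> r + h\<^sup>2 r \<bullet> C r\<close>. Finally \<open>r - g = h B C r\<close> is of order
  \<open>1 / (t + 1)\<close> relative to \<open>g\<close>.
\<close>

lemma energy_step:
  assumes x: "x = C t y" and x': "x' = x - h *\<^sub>R C t (B t x - g)"
  shows "\<exists>y'. x' = C (Suc t) y' \<and>
    x' \<bullet> y' \<le> x \<bullet> y + 2 * h * (x \<bullet> g) + growth / (real t + 1) * (norm x * norm g + (norm g)\<^sup>2)"
proof -
  define \<kappa> where "\<kappa> = 1 - \<alpha> / b"
  have \<kappa>: "0 < \<kappa>" using \<alpha>_pos \<alpha>_less by (simp add: \<kappa>_def)
  obtain r where r: "Q t r = g" using surj_Q by (metis surjE)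
  obtain y' where y': "Q t y' = y + h *\<^sub>R r" using surj_Q by (metis surjE)
  have lin: "Q t (y + h *\<^sub>R r) = Q t y + h *\<^sub>R g"
    by (simp add: linear_add[OF linear_Q] linear_scale[OF linear_Q] r)
  have "x' = C t (Q t y + h *\<^sub>R g)"
    by (simp add: x' x Q_def linear_diff[OF linear_C] linear_scale[OF linear_C] linear_add[OF linear_C] algebra_simps)
  then have eq: "x' = C (Suc t) y'" by (simp add: C_Suc y' lin)
  have "x' \<bullet> y' = C t (y + h *\<^sub>R r) \<bullet> (y + h *\<^sub>R r)"
    by (simp add: eq C_Suc C_Q y')
  also have "\<dots> = x \<bullet> y + 2 * h * (x \<bullet> r) + h * (r \<bullet> (h *\<^sub>R C t r))"
    using symmetric_C[of t r y] by (simp add: x linear_scale[OF linear_C] linear_add[OF linear_C] inner_add_left inner_add_right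
        inner_commute algebra_simps)
  finally have V: "x' \<bullet> y' = x \<bullet> y + 2 * h * (x \<bullet> r) + h * (r \<bullet> (h *\<^sub>R C t r))" .
  have nr: "norm r \<le> norm g / \<kappa>"
    using Q_lower[of r t] r \<kappa> by (simp add: \<kappa>_def[symmetric] pos_le_divide_eq mult.commute)
  have nCr: "norm (h *\<^sub>R C t r) \<le> (norm g / \<kappa>) / (\<alpha> * (real t + 1))"
    using C_decay(2)[of t r] nr h_pos \<alpha>_pos
    by (simp del: divide_divide_eq_left) (erule order_trans, intro divide_right_mono, auto)
  have "r = g + B t (h *\<^sub>R C t r)"
    using r by (simp add: Q_def linear_scale[OF linear_B] algebra_simps)
  then have "x \<bullet> r = x \<bullet> g + x \<bullet> B t (h *\<^sub>R C t r)" by (metis inner_add_right)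
  also have "x \<bullet> B t (h *\<^sub>R C t r) \<le> norm x * (b * norm (h *\<^sub>R C t r))"
    by (rule order_trans[OF norm_cauchy_schwarz mult_left_mono[OF B_upper]]) simp
  also have "\<dots> \<le> norm x * (b * ((norm g / \<kappa>) / (\<alpha> * (real t + 1))))"
    using nCr \<alpha>_pos \<alpha>_less by (intro mult_left_mono) auto
  finally have cross: "2 * h * (x \<bullet> r) \<le>
      2 * h * (x \<bullet> g + norm x * (b * ((norm g / \<kappa>) / (\<alpha> * (real t + 1)))))"
    using h_pos by (intro mult_left_mono) auto
  have "r \<bullet> (h *\<^sub>R C t r) \<le> norm r * norm (h *\<^sub>R C t r)" by (rule norm_cauchy_schwarz)
  also have "\<dots> \<le> (norm g / \<kappa>) * ((norm g / \<kappa>) / (\<alpha> * (real t + 1)))"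
    by (rule mult_mono[OF nr nCr]) (use \<kappa> in auto)
  finally have quad: "h * (r \<bullet> (h *\<^sub>R C t r)) \<le> h * ((norm g / \<kappa>) * ((norm g / \<kappa>) / (\<alpha> * (real t + 1))))"
    using h_pos by (intro mult_left_mono) auto
  define N where "N = norm x * norm g + (norm g)\<^sup>2"
  have "x' \<bullet> y' \<le> x \<bullet> y + 2 * h * (x \<bullet> g)
      + (2 * h * (b / (\<alpha> * \<kappa>)) * (norm x * norm g) + h / (\<alpha> * \<kappa>\<^sup>2) * (norm g)\<^sup>2) / (real t + 1)"
  proof -
    have "2 * h * (x \<bullet> g + norm x * (b * ((norm g / \<kappa>) / (\<alpha> * (real t + 1))))) =
        2 * h * (x \<bullet> g) + 2 * h * (b / (\<alpha> * \<kappa>)) * (norm x * norm g) / (real t + 1)"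
      by (simp add: distrib_left mult_ac)
    moreover have "h * ((norm g / \<kappa>) * ((norm g / \<kappa>) / (\<alpha> * (real t + 1)))) =
        h / (\<alpha> * \<kappa>\<^sup>2) * (norm g)\<^sup>2 / (real t + 1)"
      by (simp add: power2_eq_square mult_ac)
    ultimately show ?thesis using V cross quad unfolding add_divide_distrib by linarith
  qed
  also have "\<dots> \<le> x \<bullet> y + 2 * h * (x \<bullet> g) + (growth * N) / (real t + 1)"
  proof (intro add_left_mono divide_right_mono)
    have "2 * h * (b / (\<alpha> * \<kappa>)) * (norm x * norm g) \<le> 2 * h * (b / (\<alpha> * \<kappa>)) * N"
      "h / (\<alpha> * \<kappa>\<^sup>2) * (norm g)\<^sup>2 \<le> h / (\<alpha> * \<kappa>\<^sup>2) * N"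
      using h_pos \<alpha>_pos \<alpha>_less \<kappa> by (intro mult_left_mono; simp add: N_def)+
    then show "2 * h * (b / (\<alpha> * \<kappa>)) * (norm x * norm g) + h / (\<alpha> * \<kappa>\<^sup>2) * (norm g)\<^sup>2 \<le> growth * N"
      by (simp add: energy_growth_def \<kappa>_def[symmetric] distrib_right)
  qed simp
  finally show ?thesis using eq unfolding N_def by auto
qed

text \<open>
  The factor \<open>T + 1\<close> on the left is the decay of \<open>C T\<close>; the energy at time \<open>0\<close> is controlled by the
  lower bound \<open>\<sigma>\<close> for the initial covariance.
\<close>

lemma energy_bound:
  assumes coercive: "0 < \<sigma>" "\<And>y. \<sigma> * (norm y)\<^sup>2 \<le> y \<bullet> C 0 y"
    and x: "\<And>t. x (Suc t) = x t - h *\<^sub>R C t (B t (x t) - g t)"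
  shows "h * \<alpha> * (real T + 1) * (norm (x T))\<^sup>2 \<le> (norm (x 0))\<^sup>2 / \<sigma> +
    (\<Sum>t<T. 2 * h * (x t \<bullet> g t) + growth / (real t + 1) * (norm (x t) * norm (g t) + (norm (g t))\<^sup>2))"
proof -
  have "\<exists>y. x T = C T y \<and> x T \<bullet> y \<le> (norm (x 0))\<^sup>2 / \<sigma> +
    (\<Sum>t<T. 2 * h * (x t \<bullet> g t) + growth / (real t + 1) * (norm (x t) * norm (g t) + (norm (g t))\<^sup>2))"
  proof (induction T)
    case 0
    have "y = 0" if "C 0 y = 0" for y
      using coercive(2)[of y] coercive(1) that by (simp add: mult_le_0_iff)
    then have "inj (C 0)" using linear_injective_0[OF linear_C] by blast
    then obtain y where y: "x 0 = C 0 y"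
      using linear_inj_imp_surj[OF linear_C] by (metis surjE)
    have "\<sigma> * norm y * norm y \<le> norm (x 0) * norm y"
      using coercive(2)[of y] norm_cauchy_schwarz[of y "x 0"] by (simp add: y power2_eq_square mult_ac)
    then have "norm y \<le> norm (x 0) / \<sigma>"
      using coercive(1) by (cases "y = 0") (auto simp: pos_le_divide_eq mult.commute)
    then have "x 0 \<bullet> y \<le> norm (x 0) * (norm (x 0) / \<sigma>)"
      by (intro order_trans[OF norm_cauchy_schwarz] mult_left_mono) auto
    then show ?case using y by (auto simp: power2_eq_square)
  next
    case (Suc T)
    then obtain y where "x T = C T y" and "x T \<bullet> y \<le> (norm (x 0))\<^sup>2 / \<sigma> +
      (\<Sum>t<T. 2 * h * (x t \<bullet> g t) + growth / (real t + 1) * (norm (x t) * norm (g t) + (norm (g t))\<^sup>2))"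
      by blast
    with energy_step[OF this(1) x] show ?case by fastforce
  qed
  then obtain y where y: "x T = C T y" "x T \<bullet> y \<le> (norm (x 0))\<^sup>2 / \<sigma> +
    (\<Sum>t<T. 2 * h * (x t \<bullet> g t) + growth / (real t + 1) * (norm (x t) * norm (g t) + (norm (g t))\<^sup>2))"
    by blast
  moreover have "h * \<alpha> * (real T + 1) * (norm (x T))\<^sup>2 \<le> x T \<bullet> y"
    using C_decay(1)[of T y] by (simp only: y(1) inner_commute[of y])
  ultimately show ?thesis by linarith
qed

lemma increment_bound:
  assumes "x' = x - h *\<^sub>R C t (B t x - g)"
  shows "norm (x' - x) \<le> (b * norm x + norm g) / (\<alpha> * (real t + 1))"
proof -
  have "norm (x' - x) = h * norm (C t (B t x - g))" using assms h_pos by simp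
  also have "\<dots> \<le> norm (B t x - g) / (\<alpha> * (real t + 1))" by (rule C_decay)
  also have "\<dots> \<le> (b * norm x + norm g) / (\<alpha> * (real t + 1))"
    using norm_triangle_ineq4[of "B t x" g] B_upper[of t x] \<alpha>_pos by (intro divide_right_mono) auto
  finally show ?thesis .
qed

end

section \<open>Second moments of the Gaussian noise\<close>

text \<open>
  With \<open>x = \<Gamma> y\<close> the form of the inverse at \<open>x\<close> is the form of \<open>\<Gamma>\<close> at \<open>y\<close>.
\<close>

lemma matrix_inv_quadratic_lower:
  fixes \<Gamma> :: "real^'p^'p"
  assumes "pos_def \<Gamma>"
  obtains k where "0 < k" "\<And>x. (norm x)\<^sup>2 \<le> k * (x \<bullet> (matrix_inv \<Gamma> *v x))"
proof -
  have sym: "transpose \<Gamma> = \<Gamma>" and pos: "\<And>x. x \<noteq> 0 \<Longrightarrow> 0 < x \<bullet> (\<Gamma> *v x)"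
    using assms by (auto simp: pos_def_def)
  have "invertible \<Gamma>"
    unfolding invertible_left_inverse matrix_left_invertible_ker using pos by force
  then have inv: "\<Gamma> ** matrix_inv \<Gamma> = mat 1"
    unfolding matrix_inv_def invertible_def by (rule someI2_ex) blast
  obtain K where K: "0 < K" "\<And>x. norm (\<Gamma> *v x) \<le> norm x * K"
    using bounded_linear.pos_bounded[OF matrix_vector_mul_bounded_linear[of \<Gamma>]] by blast
  show thesis
  proof (rule that[OF K(1)])
    fix x :: "real^'p"
    define y where "y = matrix_inv \<Gamma> *v x"
    have x: "x = \<Gamma> *v y" by (simp add: y_def matrix_vector_mul_assoc inv)
    have "(norm (\<Gamma> *v y))\<^sup>2 \<le> K * (y \<bullet> (\<Gamma> *v y))"
    proof (rule psd_operator_norm_bound(1))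
      show "linear ((*v) \<Gamma>)" by simp
      show "(\<Gamma> *v p) \<bullet> q = p \<bullet> (\<Gamma> *v q)" for p q
        by (metis dot_lmul_matrix sym transpose_matrix_vector)
      show "0 \<le> p \<bullet> (\<Gamma> *v p)" for p using pos[of p] by (cases "p = 0") auto
      show "p \<bullet> (\<Gamma> *v p) \<le> K * (norm p)\<^sup>2" for p
        using mult_left_mono[OF K(2)[of p] norm_ge_zero[of p]] norm_cauchy_schwarz[of p "\<Gamma> *v p"]
        by (simp add: power2_eq_square mult_ac)
    qed
    then show "(norm x)\<^sup>2 \<le> K * (x \<bullet> (matrix_inv \<Gamma> *v x))"
      by (simp add: x[symmetric] y_def[symmetric] inner_commute)
  qed
qed

lemma lborel_integrable_scaleR:
  fixes f :: "'v::euclidean_space \<Rightarrow> real"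
  assumes c: "c \<noteq> 0" and f: "integrable lborel f"
  shows "integrable lborel (\<lambda>x. f (c *\<^sub>R x))"
proof -
  have meas [measurable]: "f \<in> borel_measurable borel" using f by simp
  have "integrable (density (distr lborel borel (\<lambda>x::'v. 0 + c *\<^sub>R x)) (\<lambda>_. ennreal (\<bar>c\<bar>^DIM('v)))) f"
    using f lborel_affine[OF c, of "0::'v"] by (simp add: ennreal_power)
  then have "integrable (distr lborel borel (\<lambda>x::'v. c *\<^sub>R x)) (\<lambda>x. \<bar>c\<bar>^DIM('v) * f x)"
    by (subst (asm) integrable_real_density) auto
  then have "integrable lborel (\<lambda>x. \<bar>c\<bar>^DIM('v) * f (c *\<^sub>R x))"
    by (subst (asm) integrable_distr_eq) auto
  then show ?thesis using c by simp
qed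

lemma lborel_integral_uminus:
  fixes f :: "'v::euclidean_space \<Rightarrow> real"
  assumes [measurable]: "f \<in> borel_measurable borel"
  shows "(\<integral>x. f (- x) \<partial>lborel) = (\<integral>x. f x \<partial>lborel)"
proof -
  have "lborel = distr lborel borel (uminus :: 'v \<Rightarrow> 'v)"
    using lborel_affine[of "-1" "0::'v"] by (simp add: density_1)
  then have "(\<integral>x. f x \<partial>lborel) = (\<integral>x. f x \<partial>(distr lborel borel (uminus :: 'v \<Rightarrow> 'v)))" by simp
  also have "\<dots> = (\<integral>x. f (- x) \<partial>lborel)" by (rule integral_distr) auto
  finally show ?thesis by simp
qed

lemma mv_normal_density_measurable [measurable]: "mv_normal_density \<Gamma> \<in> borel_measurable borel"
proof -
  have "continuous_on UNIV (\<lambda>x. exp (- (x \<bullet> (matrix_inv \<Gamma> *v x)) / 2))"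
    by (intro continuous_intros linear_continuous_on_compose[OF continuous_on_id]) simp
  then have "(\<lambda>x. exp (- (x \<bullet> (matrix_inv \<Gamma> *v x)) / 2)) \<in> borel_measurable borel"
    by (rule borel_measurable_continuous_onI)
  then show ?thesis unfolding mv_normal_density_def[abs_def] by measurable
qed

context prob_space
begin

text \<open>
  That the density integrates to one is part of the hypothesis, and this settles both the sign of
  the normalizing constant and integrability: half of the Gaussian exponent absorbs the factor
  \<open>(norm x)\<^sup>2\<close>, and the other half is the same density rescaled. The mean vanishes by symmetry. The
  second moment is given as an integral in which \<open>W\<close> does not occur, so that it is the same for all
  noise variables with this density.
\<close>

lemma mv_normal_moments:
  fixes \<Gamma> :: "real^'p^'p" and W :: "'a \<Rightarrow> real^'p"
  assumes pd: "pos_def \<Gamma>"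
    and dist: "distributed M lborel W (\<lambda>x. ennreal (mv_normal_density \<Gamma> x))"
  shows "integrable M (\<lambda>\<omega>. (norm (W \<omega>))\<^sup>2)"
    and "expectation (\<lambda>\<omega>. (norm (W \<omega>))\<^sup>2) = (\<integral>x. mv_normal_density \<Gamma> x * (norm x)\<^sup>2 \<partial>lborel)"
    and "expectation (\<lambda>\<omega>. W \<omega> $ i) = 0"
proof -
  let ?f = "mv_normal_density \<Gamma>"
  define N where "N = sqrt ((2 * pi) ^ CARD('p) * det \<Gamma>)"
  have f: "?f x = exp (- (x \<bullet> (matrix_inv \<Gamma> *v x)) / 2) / N" for x
    by (simp add: mv_normal_density_def N_def)
  have total: "(\<integral>\<^sup>+ x. ennreal (?f x) \<partial>lborel) = 1"
    using distributed_nn_integral[OF dist, of "\<lambda>_. 1"] emeasure_space_1 by simp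
  have N: "0 < N"
  proof (rule ccontr)
    assume "\<not> 0 < N"
    then have "ennreal (?f x) = 0" for x by (simp add: f ennreal_eq_0_iff divide_nonneg_nonpos)
    then show False using total by simp
  qed
  have f_nonneg: "0 \<le> ?f x" for x using N by (simp add: f)
  have f_int: "integrable lborel ?f"
    using total f_nonneg by (intro integrableI_nonneg) auto
  obtain k where k: "0 < k" "\<And>x. (norm x)\<^sup>2 \<le> k * (x \<bullet> (matrix_inv \<Gamma> *v x))"
    using matrix_inv_quadratic_lower[OF pd] by blast
  \<comment> \<open>Rescaling by \<open>1 / sqrt 2\<close> halves the exponent.\<close>
  define c :: real where "c = 1 / sqrt 2"
  have c: "c \<noteq> 0" "c * c = 1/2" by (auto simp: c_def)
  have dom: "?f x * (norm x)\<^sup>2 \<le> 4 * k * ?f (c *\<^sub>R x)" for x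
  proof -
    let ?q = "x \<bullet> (matrix_inv \<Gamma> *v x)"
    have q: "0 \<le> ?q" using k(1) order_trans[OF zero_le_power2 k(2)[of x]] by (simp add: zero_le_mult_iff)
    have "?q \<le> 4 * exp (?q / 4)" using exp_ge_add_one_self[of "?q / 4"] by linarith
    then have "?q * exp (- ?q / 2) \<le> 4 * exp (?q / 4) * exp (- ?q / 2)"
      by (intro mult_right_mono) auto
    also have "\<dots> = 4 * exp (- ?q / 4)" by (simp flip: exp_add)
    finally have 1: "k * (?q * exp (- ?q / 2)) \<le> k * (4 * exp (- ?q / 4))" using k by simp
    have "exp (- ?q / 2) * (norm x)\<^sup>2 \<le> exp (- ?q / 2) * (k * ?q)"
      by (intro mult_left_mono k) auto
    also have "\<dots> \<le> 4 * k * exp (- ?q / 4)" using 1 by (simp add: mult_ac)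
    finally have "exp (- ?q / 2) * (norm x)\<^sup>2 / N \<le> 4 * k * exp (- ?q / 4) / N"
      using N by (intro divide_right_mono) auto
    moreover have "(c *\<^sub>R x) \<bullet> (matrix_inv \<Gamma> *v (c *\<^sub>R x)) = c * c * ?q"
      by (simp add: linear_scale[OF matrix_vector_mul_linear])
    then have "?f (c *\<^sub>R x) = exp (- ?q / 4) / N" by (simp add: f c(2))
    moreover have "?f x * (norm x)\<^sup>2 = exp (- ?q / 2) * (norm x)\<^sup>2 / N" by (simp add: f)
    ultimately show ?thesis by (metis times_divide_eq_right)
  qed
  have int2: "integrable lborel (\<lambda>x. ?f x * (norm x)\<^sup>2)"
  proof (rule Bochner_Integration.integrable_bound)
    show "integrable lborel (\<lambda>x. 4 * k * ?f (c *\<^sub>R x))"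
      by (intro integrable_mult_right lborel_integrable_scaleR c f_int)
    show "AE x in lborel. norm (?f x * (norm x)\<^sup>2) \<le> norm (4 * k * ?f (c *\<^sub>R x))"
      using dom f_nonneg k by (auto simp: abs_mult)
  qed auto
  show "integrable M (\<lambda>\<omega>. (norm (W \<omega>))\<^sup>2)"
    using int2 distributed_integrable[OF dist, of "\<lambda>x. (norm x)\<^sup>2"] f_nonneg by simp
  show "expectation (\<lambda>\<omega>. (norm (W \<omega>))\<^sup>2) = (\<integral>x. ?f x * (norm x)\<^sup>2 \<partial>lborel)"
    using distributed_integral[OF dist, of "\<lambda>x. (norm x)\<^sup>2"] f_nonneg by simp
  have even: "?f (- x) = ?f x" for x
    by (simp add: f linear_neg[OF matrix_vector_mul_linear])
  have [measurable]: "(\<lambda>x::real^'p. x $ i) \<in> borel_measurable borel"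
    by (intro borel_measurable_continuous_onI continuous_intros)
  have "(\<integral>x. ?f x * x $ i \<partial>lborel) = - (\<integral>x. ?f x * x $ i \<partial>lborel)"
    using lborel_integral_uminus[of "\<lambda>x. ?f x * x $ i"] by (simp add: even)
  then show "expectation (\<lambda>\<omega>. W \<omega> $ i) = 0"
    using distributed_integral[OF dist, of "\<lambda>x. x $ i"] f_nonneg by simp
qed

end

section \<open>The ensemble covariance and the error of the ensemble mean\<close>

lemma ens_cov_mult_vec:
  fixes Z :: "'j::finite \<Rightarrow> real^'d"
  shows "ens_cov Z *v y = (1 / real CARD('j)) *\<^sub>R (\<Sum>j\<in>UNIV. (ens_spread Z j \<bullet> y) *\<^sub>R ens_spread Z j)"
proof -
  have "(\<Sum>k\<in>UNIV. (\<Sum>j\<in>UNIV. ens_spread Z j $ i * ens_spread Z j $ k) * y $ k) =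
        (\<Sum>j\<in>UNIV. (\<Sum>k\<in>UNIV. ens_spread Z j $ k * y $ k) * ens_spread Z j $ i)" for i
    unfolding sum_distrib_right by (subst sum.swap) (simp add: mult_ac)
  then show ?thesis
    by (simp add: vec_eq_iff matrix_vector_mult_def ens_cov_def inner_vec_def sum_divide_distrib[symmetric])
qed

lemma ens_cov_symmetric: "(ens_cov Z *v p) \<bullet> y = p \<bullet> (ens_cov Z *v y)"
  by (simp add: ens_cov_mult_vec inner_sum_left inner_sum_right inner_commute mult.commute)

lemma ens_cov_quadratic:
  fixes Z :: "'j::finite \<Rightarrow> real^'d"
  shows "y \<bullet> (ens_cov Z *v y) = 1 / real CARD('j) * (\<Sum>j\<in>UNIV. (ens_spread Z j \<bullet> y)\<^sup>2)"
  by (simp add: ens_cov_mult_vec inner_sum_right power2_eq_square inner_commute)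

lemma ens_cov_psd: "0 \<le> y \<bullet> (ens_cov Z *v y)"
  by (simp add: ens_cov_quadratic sum_nonneg)

lemma ens_energy_nonneg: "0 \<le> ens_energy Z"
  by (simp add: ens_energy_def sum_nonneg)

lemma ens_cov_le_energy: "y \<bullet> (ens_cov Z *v y) \<le> ens_energy Z * (norm y)\<^sup>2"
proof -
  have "(ens_spread Z j \<bullet> y)\<^sup>2 \<le> (norm (ens_spread Z j))\<^sup>2 * (norm y)\<^sup>2" for j
    using Cauchy_Schwarz_ineq[of "ens_spread Z j" y] by (simp add: power2_norm_eq_inner)
  then show ?thesis
    unfolding ens_cov_quadratic ens_energy_def mult.assoc sum_distrib_right
    by (intro mult_left_mono sum_mono) auto
qed

lemma gram_mult_vec: "gram S *v y = transpose S *v (S *v y)"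
  by (simp add: gram_def matrix_vector_mul_assoc)

lemma transpose_inner: "(transpose S *v p) \<bullet> y = p \<bullet> (S *v y)"
  for S :: "real^'d^'p"
  by (metis dot_lmul_matrix inner_commute transpose_matrix_vector)

lemma gram_symmetric: "(gram S *v p) \<bullet> y = p \<bullet> (gram S *v y)"
  by (metis gram_mult_vec transpose_inner inner_commute)

lemma gram_quadratic: "y \<bullet> (gram S *v y) = (norm (S *v y))\<^sup>2"
  by (metis gram_mult_vec transpose_inner inner_commute power2_norm_eq_inner)

lemma op_norm_bound: "norm (X *v y) \<le> op_norm X * norm y"
  unfolding op_norm_def by (rule onorm) (rule matrix_vector_mul_bounded_linear)

lemma
  fixes S :: "real^'d^'p"
  assumes "op_norm (gram S) \<le> a" and a: "0 \<le> a"
  shows norm_gram_le: "norm (gram S *v y) \<le> a * norm y"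
    and norm_factor_le: "norm (S *v y) \<le> sqrt a * norm y"
    and norm_transpose_le: "norm (transpose S *v v) \<le> sqrt a * norm v"
proof -
  show gram: "norm (gram S *v y) \<le> a * norm y" for y
    using op_norm_bound[of "gram S" y] assms(1) by (meson mult_right_mono norm_ge_zero order_trans)
  show factor: "norm (S *v y) \<le> sqrt a * norm y" for y
  proof (rule power2_le_imp_le)
    have "(norm (S *v y))\<^sup>2 \<le> norm y * norm (gram S *v y)"
      using norm_cauchy_schwarz[of y "gram S *v y"] by (simp add: gram_quadratic)
    also have "\<dots> \<le> norm y * (a * norm y)" by (intro mult_left_mono gram) auto
    also have "\<dots> = (sqrt a * norm y)\<^sup>2" using a by (simp add: power_mult_distrib power2_eq_square)
    finally show "(norm (S *v y))\<^sup>2 \<le> (sqrt a * norm y)\<^sup>2" .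
  qed (use a in simp)
  let ?p = "transpose S *v v"
  have "norm ?p * norm ?p = v \<bullet> (S *v ?p)"
    by (metis transpose_inner power2_norm_eq_inner power2_eq_square)
  also have "\<dots> \<le> norm v * (sqrt a * norm ?p)"
    by (rule order_trans[OF norm_cauchy_schwarz mult_left_mono[OF factor]]) simp
  finally show "norm ?p \<le> sqrt a * norm v"
    by (cases "norm ?p = 0") (use a in \<open>auto simp: mult_ac\<close>)
qed

text \<open>
  The Hessian \<open>S\<^sup>T S + \<alpha> I\<close> of the regularized data misfit of a single observation.
\<close>

definition reg_gram :: "real^'d^'p \<Rightarrow> real \<Rightarrow> real^'d \<Rightarrow> real^'d" where
  "reg_gram S \<alpha> y = gram S *v y + \<alpha> *\<^sub>R y"

lemma linear_reg_gram: "linear (reg_gram S \<alpha>)"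
  unfolding reg_gram_def
  by (intro linear_compose_add matrix_vector_mul_linear linear_compose_scale_right linear_ident)

lemma reg_gram_symmetric: "reg_gram S \<alpha> p \<bullet> y = p \<bullet> reg_gram S \<alpha> y"
  by (simp add: reg_gram_def inner_add_left inner_add_right gram_symmetric)

lemma reg_gram_lower: "\<alpha> * (norm y)\<^sup>2 \<le> y \<bullet> reg_gram S \<alpha> y"
  by (simp add: reg_gram_def inner_add_right gram_quadratic power2_norm_eq_inner)

lemma reg_gram_upper:
  assumes "op_norm (gram S) \<le> a" "0 \<le> a" "0 \<le> \<alpha>"
  shows "norm (reg_gram S \<alpha> y) \<le> (a + \<alpha>) * norm y"
  using norm_triangle_ineq[of "gram S *v y" "\<alpha> *\<^sub>R y"] norm_gram_le[OF assms(1,2), of y] assms(3)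
  by (simp add: reg_gram_def distrib_right)

lemma ens_mean_deki_step:
  "ens_mean (deki_step \<alpha> \<eta> S u Z) =
   ens_mean Z - \<eta> *\<^sub>R (ens_cov Z *v (reg_gram S \<alpha> (ens_mean Z) - transpose S *v u))"
  for Z :: "'j::finite \<Rightarrow> real^'d"
proof -
  define c where "c = 1 / real CARD('j)"
  define G where "G z = z - \<eta> *\<^sub>R (ens_cov Z *v reg_gram S \<alpha> z)" for z
  define k where "k = \<eta> *\<^sub>R (ens_cov Z *v (transpose S *v u))"
  have linG: "linear G"
    unfolding G_def
    by (intro linear_compose_sub linear_ident linear_compose_scale_right
        linear_compose[OF linear_reg_gram matrix_vector_mul_linear, unfolded o_def])
  have "deki_step \<alpha> \<eta> S u Z j = G (Z j) + k" for j
    by (simp add: deki_step_def G_def k_def reg_gram_def gram_mult_vec matrix_vector_mult_diff_distrib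
        matrix_vector_right_distrib algebra_simps)
  then have "ens_mean (deki_step \<alpha> \<eta> S u Z) = c *\<^sub>R (\<Sum>j\<in>UNIV. G (Z j)) + (c * real CARD('j)) *\<^sub>R k"
    by (simp add: ens_mean_def c_def sum.distrib scaleR_right_distrib sum_constant_scaleR del: sum_constant)
  also have "\<dots> = G (ens_mean Z) + k"
    by (simp add: ens_mean_def c_def linear_scale[OF linG] linear_sum[OF linG])
  finally show ?thesis
    by (simp add: G_def k_def matrix_vector_mult_diff_distrib algebra_simps)
qed

lemma ens_spread_deki_step:
  "ens_spread (deki_step \<alpha> \<eta> S u Z) j =
   ens_spread Z j - \<eta> *\<^sub>R (ens_cov Z *v reg_gram S \<alpha> (ens_spread Z j))"
  by (simp add: ens_spread_def ens_mean_deki_step deki_step_def reg_gram_def gram_mult_vec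
      matrix_vector_mult_diff_distrib matrix_vector_right_distrib algebra_simps)

text \<open>
  The data enter all particles alike, so they cancel in the spread, which is propagated by the
  linear map \<open>P\<close>; the covariance is therefore propagated by congruence with \<open>P\<close>.
\<close>

lemma ens_cov_deki_step:
  defines "Q Z S \<alpha> \<eta> y \<equiv> y - \<eta> *\<^sub>R reg_gram S \<alpha> (ens_cov Z *v y)"
  shows "ens_cov (deki_step \<alpha> \<eta> S u Z) *v y = ens_cov Z *v Q Z S \<alpha> \<eta> (Q Z S \<alpha> \<eta> y)"
proof -
  define P where "P y = y - \<eta> *\<^sub>R (ens_cov Z *v reg_gram S \<alpha> y)" for y
  have linP: "linear P"
    unfolding P_def
    by (intro linear_compose_sub linear_ident linear_compose_scale_right
        linear_compose[OF linear_reg_gram matrix_vector_mul_linear, unfolded o_def])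
  have adj: "P p \<bullet> y = p \<bullet> Q Z S \<alpha> \<eta> y" for p y
    by (simp add: P_def Q_def inner_diff_left inner_diff_right ens_cov_symmetric reg_gram_symmetric)
  have "ens_cov (deki_step \<alpha> \<eta> S u Z) *v y = P (ens_cov Z *v Q Z S \<alpha> \<eta> y)"
    by (simp add: ens_cov_mult_vec[of "deki_step \<alpha> \<eta> S u Z"] ens_spread_deki_step P_def[symmetric] adj
        ens_cov_mult_vec[of Z "Q Z S \<alpha> \<eta> y"] linear_scale[OF linP] linear_sum[OF linP])
  also have "\<dots> = ens_cov Z *v Q Z S \<alpha> \<eta> (Q Z S \<alpha> \<eta> y)"
    by (simp add: P_def Q_def matrix_vector_mult_diff_distrib linear_scale[OF matrix_vector_mul_linear])
  finally show ?thesis .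
qed

text \<open>
  The driving force of the error recursion: observation noise minus the deviation of the current
  data matrix from its limit \<open>A\<close>.
\<close>

definition data_error :: "real^'d^'d \<Rightarrow> real^'d \<Rightarrow> real^'d^'p \<Rightarrow> real^'p \<Rightarrow> real^'d" where
  "data_error A v S w = transpose S *v w - (gram S - A) *v v"

lemma mat_mult_vec: "mat c *v x = c *\<^sub>R x"
  for x :: "real^'n"
  by (simp add: vec_eq_iff matrix_vector_mult_def mat_def if_distrib[of "\<lambda>c. c * _"] cong: if_cong)

text \<open>
  Substituting the normal equation of \<open>zo\<close> collects all data terms in \<open>data_error\<close>.
\<close>

lemma ens_mean_error_step:
  assumes zo: "(A + mat \<alpha>) *v zo = A *v zs"
  shows "ens_mean (deki_step \<alpha> \<eta> S (S *v zs + w) Z) - zo =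
    (ens_mean Z - zo) -
      \<eta> *\<^sub>R (ens_cov Z *v (reg_gram S \<alpha> (ens_mean Z - zo) - data_error A (zo - zs) S w))"
proof -
  have "A *v zo + \<alpha> *\<^sub>R zo = A *v zs"
    using zo by (simp add: matrix_vector_mult_add_rdistrib mat_mult_vec)
  then have "reg_gram S \<alpha> (ens_mean Z) - transpose S *v (S *v zs + w) =
      reg_gram S \<alpha> (ens_mean Z - zo) - data_error A (zo - zs) S w"
    by (simp add: reg_gram_def data_error_def gram_mult_vec matrix_vector_right_distrib
        matrix_vector_mult_diff_distrib matrix_vector_mult_diff_rdistrib algebra_simps)
  then show ?thesis by (simp add: ens_mean_deki_step)
qed

section \<open>Mean-square decay under a bias that decorrelates with delay\<close>

lemma norm_mult_le_sum_squares: "norm x * norm y \<le> ((norm x)\<^sup>2 + (norm y)\<^sup>2) / 2"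
  using sum_squares_bound[of "norm x" "norm y"] by simp

lemma norm_le_one_plus_square: "norm x \<le> 1 + (norm x)\<^sup>2"
proof -
  have "0 \<le> (norm x - 1 / 2)\<^sup>2" by simp
  then show ?thesis by (simp add: power2_eq_square algebra_simps)
qed

text \<open>
  The total cost of replacing the error at time \<open>t\<close> by the one at time \<open>t - d\<close>, per unit of delay.
  The first \<open>d + 1\<close> times are excluded, as they admit no delay within the ergodic range.
\<close>

lemma sum_shifted_harmonic:
  "(\<Sum>t<T. if t \<le> d then 0 else 1 / (real (t - d) + 1)) \<le> harm T"
proof -
  have "(\<Sum>t<T. if t \<le> d then 0 else 1 / (real (t - d) + 1)) \<le> harm (T - d)"
  proof (induction T)
    case (Suc T)
    then show ?case by (cases "T < d") (auto simp: Suc_diff_le harm_Suc divide_inverse add.commute)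
  qed (simp add: harm_nonneg)
  also have "\<dots> \<le> harm T" by (rule harm_mono) simp
  finally show ?thesis .
qed

lemma harm_le_one_plus_ln:
  assumes "1 \<le> T"
  shows "harm T \<le> 1 + ln (real T)"
proof -
  obtain m where T: "T = Suc m" using assms by (cases T) auto
  show ?thesis
    using decseqD[OF decseq_harm_diff_ln, of 0 m] by (simp add: T harm_Suc harm_expand)
qed

lemma (in prob_space) integrable_norm_of_moment:
  fixes f :: "'a \<Rightarrow> 'v::euclidean_space"
  assumes [measurable]: "f \<in> borel_measurable M" and "integrable M (\<lambda>\<omega>. (norm (f \<omega>))\<^sup>2)"
  shows "integrable M (\<lambda>\<omega>. norm (f \<omega>))"
proof (rule Bochner_Integration.integrable_bound)
  show "integrable M (\<lambda>\<omega>. 1 + (norm (f \<omega>))\<^sup>2)" using assms by simp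
  show "AE \<omega> in M. norm (norm (f \<omega>)) \<le> norm (1 + (norm (f \<omega>))\<^sup>2)"
    using norm_le_one_plus_square by (intro AE_I2) (simp add: abs_of_nonneg)
qed simp

text \<open>
  The probabilistic content of the pathwise bounds: an error driven by noise and bounded bias whose
  increments are of order \<open>1 / (t + 1)\<close> and whose square, multiplied by \<open>T + 1\<close>, is dominated by the
  accumulated work of the driving force.
\<close>

locale error_process = prob_space M
  for M :: "'a measure" +
  fixes x noise bias :: "nat \<Rightarrow> 'a \<Rightarrow> 'v::euclidean_space"
    and k h c s L N \<beta> :: real
  assumes x_meas [measurable]: "x t \<in> borel_measurable M"
    and noise_meas [measurable]: "noise t \<in> borel_measurable M"
    and bias_meas [measurable]: "bias t \<in> borel_measurable M"
    and initial_moment: "integrable M (\<lambda>\<omega>. (norm (x 0 \<omega>))\<^sup>2)"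
    and noise_moment: "integrable M (\<lambda>\<omega>. (norm (noise t \<omega>))\<^sup>2)"
    and noise_variance: "expectation (\<lambda>\<omega>. (norm (noise t \<omega>))\<^sup>2) \<le> N"
    and bias_bounded: "AE \<omega> in M. norm (bias t \<omega>) \<le> \<beta>"
    and increment: "AE \<omega> in M. norm (x (Suc t) \<omega> - x t \<omega>) \<le>
      L / (real t + 1) * (norm (x t \<omega>) + norm (noise t \<omega> - bias t \<omega>))"
    and energy: "AE \<omega> in M. k * (real T + 1) * (norm (x T \<omega>))\<^sup>2 \<le> s * (norm (x 0 \<omega>))\<^sup>2 +
      (\<Sum>t<T. 2 * h * (x t \<omega> \<bullet> (noise t \<omega> - bias t \<omega>)) + c / (real t + 1) *
        (norm (x t \<omega>) * norm (noise t \<omega> - bias t \<omega>) + (norm (noise t \<omega> - bias t \<omega>))\<^sup>2))"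
    and k_pos: "0 < k" and h_nonneg: "0 \<le> h" and c_nonneg: "0 \<le> c" and s_nonneg: "0 \<le> s"
    and L_nonneg: "0 \<le> L" and \<beta>_nonneg: "0 \<le> \<beta>"
begin

definition g :: "nat \<Rightarrow> 'a \<Rightarrow> 'v" where "g t \<omega> = noise t \<omega> - bias t \<omega>"
definition msq :: "nat \<Rightarrow> real" where "msq t = expectation (\<lambda>\<omega>. (norm (x t \<omega>))\<^sup>2)"
definition G :: real where "G = 2 * N + 2 * \<beta>\<^sup>2"

lemma g_meas [measurable]: "g t \<in> borel_measurable M"
  unfolding g_def by measurable

lemma g_square_le: "AE \<omega> in M. (norm (g t \<omega>))\<^sup>2 \<le> 2 * (norm (noise t \<omega>))\<^sup>2 + 2 * \<beta>\<^sup>2"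
  using bias_bounded[of t]
proof eventually_elim
  case (elim \<omega>)
  have "(norm (g t \<omega>))\<^sup>2 \<le> (norm (noise t \<omega>) + \<beta>)\<^sup>2"
    using norm_triangle_ineq4[of "noise t \<omega>" "bias t \<omega>"] elim
    by (intro power_mono) (auto simp: g_def)
  also have "\<dots> \<le> 2 * (norm (noise t \<omega>))\<^sup>2 + 2 * \<beta>\<^sup>2"
    using sum_squares_bound[of "norm (noise t \<omega>)" \<beta>] by (simp add: power2_sum)
  finally show ?case .
qed

lemma g_moment: "integrable M (\<lambda>\<omega>. (norm (g t \<omega>))\<^sup>2)"
proof (rule Bochner_Integration.integrable_bound)
  show "integrable M (\<lambda>\<omega>. 2 * (norm (noise t \<omega>))\<^sup>2 + 2 * \<beta>\<^sup>2)"
    by (intro Bochner_Integration.integrable_add integrable_mult_right noise_moment integrable_const)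
  show "AE \<omega> in M. norm ((norm (g t \<omega>))\<^sup>2) \<le> norm (2 * (norm (noise t \<omega>))\<^sup>2 + 2 * \<beta>\<^sup>2)"
    using g_square_le[of t] by eventually_elim simp
qed simp

lemma g_variance: "expectation (\<lambda>\<omega>. (norm (g t \<omega>))\<^sup>2) \<le> G"
proof -
  have "expectation (\<lambda>\<omega>. (norm (g t \<omega>))\<^sup>2) \<le> expectation (\<lambda>\<omega>. 2 * (norm (noise t \<omega>))\<^sup>2 + 2 * \<beta>\<^sup>2)"
    using g_square_le[of t] noise_moment
    by (intro integral_mono_AE g_moment Bochner_Integration.integrable_add integrable_mult_right) auto
  also have "\<dots> = 2 * expectation (\<lambda>\<omega>. (norm (noise t \<omega>))\<^sup>2) + 2 * \<beta>\<^sup>2"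
    using noise_moment[of t] by (simp add: prob_space)
  finally show ?thesis using noise_variance[of t] by (simp add: G_def)
qed

lemma x_moment: "integrable M (\<lambda>\<omega>. (norm (x t \<omega>))\<^sup>2)"
proof (induction t)
  case (Suc t)
  show ?case
  proof (rule Bochner_Integration.integrable_bound)
    show "integrable M (\<lambda>\<omega>. 2 * (1 + L)\<^sup>2 * (norm (x t \<omega>))\<^sup>2 + 2 * L\<^sup>2 * (norm (g t \<omega>))\<^sup>2)"
      by (intro Bochner_Integration.integrable_add integrable_mult_right Suc g_moment)
    show "AE \<omega> in M. norm ((norm (x (Suc t) \<omega>))\<^sup>2) \<le>
      norm (2 * (1 + L)\<^sup>2 * (norm (x t \<omega>))\<^sup>2 + 2 * L\<^sup>2 * (norm (g t \<omega>))\<^sup>2)"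
      using increment[of t]
    proof eventually_elim
      case (elim \<omega>)
      let ?a = "norm (x t \<omega>)" and ?b = "norm (g t \<omega>)"
      have "L / (real t + 1) * (?a + ?b) \<le> L / 1 * (?a + ?b)"
        using L_nonneg by (intro mult_right_mono divide_left_mono) auto
      then have "norm (x (Suc t) \<omega>) \<le> (1 + L) * ?a + L * ?b"
        using elim norm_triangle_sub[of "x (Suc t) \<omega>" "x t \<omega>"] by (simp add: g_def algebra_simps)
      then have "(norm (x (Suc t) \<omega>))\<^sup>2 \<le> ((1 + L) * ?a + L * ?b)\<^sup>2"
        by (intro power_mono) auto
      also have "\<dots> \<le> 2 * ((1 + L) * ?a)\<^sup>2 + 2 * (L * ?b)\<^sup>2"
        using sum_squares_bound[of "(1 + L) * ?a" "L * ?b"] unfolding power2_sum by linarith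
      finally show ?case by (simp add: power_mult_distrib mult.assoc)
    qed
  qed simp
qed (rule initial_moment)

lemma x_integrable: "integrable M (\<lambda>\<omega>. norm (x t \<omega>))"
  by (rule integrable_norm_of_moment[OF x_meas x_moment])

lemma g_integrable: "integrable M (\<lambda>\<omega>. norm (g t \<omega>))"
  by (rule integrable_norm_of_moment[OF g_meas g_moment])

lemma xg_integrable: "integrable M (\<lambda>\<omega>. norm (x t \<omega>) * norm (g t \<omega>))"
proof (rule Bochner_Integration.integrable_bound)
  show "integrable M (\<lambda>\<omega>. ((norm (x t \<omega>))\<^sup>2 + (norm (g t \<omega>))\<^sup>2) / 2)"
    using x_moment g_moment by simp
  show "AE \<omega> in M. norm (norm (x t \<omega>) * norm (g t \<omega>)) \<le> norm (((norm (x t \<omega>))\<^sup>2 + (norm (g t \<omega>))\<^sup>2) / 2)"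
    using norm_mult_le_sum_squares by (intro AE_I2) simp
qed simp

lemma inner_integrable:
  fixes f f' :: "'a \<Rightarrow> 'v"
  assumes "integrable M (\<lambda>\<omega>. norm (f \<omega>) * norm (f' \<omega>))"
    and [measurable]: "f \<in> borel_measurable M" "f' \<in> borel_measurable M"
  shows "integrable M (\<lambda>\<omega>. f \<omega> \<bullet> f' \<omega>)"
  by (rule Bochner_Integration.integrable_bound[OF assms(1)])
    (use Cauchy_Schwarz_ineq2 in auto)

lemma bias_integrable:
  assumes "f \<in> borel_measurable M" and int: "integrable M (\<lambda>\<omega>. norm (f \<omega>))"
  shows "integrable M (\<lambda>\<omega>. f \<omega> \<bullet> bias t \<omega>)"
    and "\<bar>expectation (\<lambda>\<omega>. f \<omega> \<bullet> bias t \<omega>)\<bar> \<le> \<beta> * expectation (\<lambda>\<omega>. norm (f \<omega>))"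
proof -
  note [measurable] = assms(1)
  have bound: "AE \<omega> in M. \<bar>f \<omega> \<bullet> bias t \<omega>\<bar> \<le> \<beta> * norm (f \<omega>)"
    using bias_bounded[of t]
  proof eventually_elim
    case (elim \<omega>)
    show ?case
      using Cauchy_Schwarz_ineq2[of "f \<omega>" "bias t \<omega>"] mult_left_mono[OF elim norm_ge_zero[of "f \<omega>"]]
      by (simp add: mult.commute)
  qed
  have int': "integrable M (\<lambda>\<omega>. \<beta> * norm (f \<omega>))" using int by simp
  show 1: "integrable M (\<lambda>\<omega>. f \<omega> \<bullet> bias t \<omega>)"
    by (rule Bochner_Integration.integrable_bound[OF int'])
      (use bound in \<open>auto elim!: eventually_mono\<close>)
  have "\<bar>expectation (\<lambda>\<omega>. f \<omega> \<bullet> bias t \<omega>)\<bar> \<le> expectation (\<lambda>\<omega>. \<bar>f \<omega> \<bullet> bias t \<omega>\<bar>)"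
    by (rule integral_abs_bound)
  also have "\<dots> \<le> expectation (\<lambda>\<omega>. \<beta> * norm (f \<omega>))"
    using 1 by (intro integral_mono_AE int' bound) auto
  finally show "\<bar>expectation (\<lambda>\<omega>. f \<omega> \<bullet> bias t \<omega>)\<bar> \<le> \<beta> * expectation (\<lambda>\<omega>. norm (f \<omega>))" by simp
qed

lemma energy_expectation:
  "k * (real T + 1) * msq T \<le> s * msq 0 +
    (\<Sum>t<T. 2 * h * expectation (\<lambda>\<omega>. x t \<omega> \<bullet> g t \<omega>) + c / (real t + 1) *
      (expectation (\<lambda>\<omega>. norm (x t \<omega>) * norm (g t \<omega>)) + expectation (\<lambda>\<omega>. (norm (g t \<omega>))\<^sup>2)))"
proof -
  note ints = xg_integrable g_moment x_moment inner_integrable[OF xg_integrable x_meas g_meas]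
  have "expectation (\<lambda>\<omega>. k * (real T + 1) * (norm (x T \<omega>))\<^sup>2) \<le> expectation (\<lambda>\<omega>. s * (norm (x 0 \<omega>))\<^sup>2 +
      (\<Sum>t<T. 2 * h * (x t \<omega> \<bullet> g t \<omega>) + c / (real t + 1) *
        (norm (x t \<omega>) * norm (g t \<omega>) + (norm (g t \<omega>))\<^sup>2)))"
    by (rule integral_mono_AE)
      (use energy[of T] in \<open>auto simp: g_def[symmetric] intro!: ints Bochner_Integration.integrable_add integrable_mult_right Bochner_Integration.integrable_sum\<close>)
  also have "\<dots> = s * msq 0 +
    (\<Sum>t<T. 2 * h * expectation (\<lambda>\<omega>. x t \<omega> \<bullet> g t \<omega>) + c / (real t + 1) *
      (expectation (\<lambda>\<omega>. norm (x t \<omega>) * norm (g t \<omega>)) + expectation (\<lambda>\<omega>. (norm (g t \<omega>))\<^sup>2)))"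
    by (simp add: msq_def ints Bochner_Integration.integral_add Bochner_Integration.integral_sum)
  finally show ?thesis by (simp add: msq_def)
qed

lemma msq_nonneg: "0 \<le> msq t"
  by (simp add: msq_def)

lemma G_nonneg: "0 \<le> G"
  using g_variance[of 0] by (rule order_trans[rotated]) simp

text \<open>
  A first crude estimate: by Young's inequality with small weight \<open>\<delta>\<close>, the work done in one step is at
  most \<open>k / 2\<close> times the current mean square plus a constant. The factor \<open>T + 1\<close> in the energy bound
  then lets a uniform bound \<open>K\<close> propagate by strong induction.
\<close>

lemma msq_bounded:
  obtains K where "0 \<le> K" "\<And>t. msq t \<le> K"
proof -
  define \<delta> where "\<delta> = k / (2 * (2 * h + c) + 1)"
  have den: "0 < 2 * (2 * h + c) + 1" using h_nonneg c_nonneg by simp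
  have \<delta>: "0 < \<delta>" using k_pos den by (simp add: \<delta>_def)
  have hc\<delta>: "(2 * h + c) * \<delta> \<le> k / 2"
    using k_pos den by (simp add: \<delta>_def field_simps)
  define D where "D = (2 * h + c) * (G / \<delta>) + c * G"
  have D: "0 \<le> D" using h_nonneg c_nonneg \<delta> G_nonneg by (simp add: D_def)
  have prod: "expectation (\<lambda>\<omega>. norm (x t \<omega>) * norm (g t \<omega>)) \<le> \<delta> * msq t + G / \<delta>" for t
  proof -
    have young: "a * b \<le> \<delta> * a\<^sup>2 + b\<^sup>2 / \<delta>" if "0 \<le> a" "0 \<le> b" for a b :: real
    proof -
      have "2 * (\<delta> * a) * b \<le> (\<delta> * a)\<^sup>2 + b\<^sup>2" by (rule sum_squares_bound)
      moreover have "0 \<le> \<delta> * a * b" using that \<delta> by simp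
      ultimately have "\<delta> * (a * b) \<le> \<delta> * (\<delta> * a\<^sup>2 + b\<^sup>2 / \<delta>)"
        using \<delta> by (simp add: power2_eq_square distrib_left mult_ac)
      then show ?thesis using \<delta> by (simp only: mult_le_cancel_left_pos)
    qed
    have "expectation (\<lambda>\<omega>. norm (x t \<omega>) * norm (g t \<omega>)) \<le>
        expectation (\<lambda>\<omega>. \<delta> * (norm (x t \<omega>))\<^sup>2 + (norm (g t \<omega>))\<^sup>2 / \<delta>)"
      using x_moment g_moment by (intro integral_mono xg_integrable young) auto
    also have "\<dots> = \<delta> * msq t + expectation (\<lambda>\<omega>. (norm (g t \<omega>))\<^sup>2) / \<delta>"
      using x_moment g_moment by (simp add: msq_def)
    also have "\<dots> \<le> \<delta> * msq t + G / \<delta>"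
      using g_variance[of t] \<delta> by (intro add_left_mono divide_right_mono) auto
    finally show ?thesis .
  qed
  have summand: "2 * h * expectation (\<lambda>\<omega>. x t \<omega> \<bullet> g t \<omega>) + c / (real t + 1) *
      (expectation (\<lambda>\<omega>. norm (x t \<omega>) * norm (g t \<omega>)) + expectation (\<lambda>\<omega>. (norm (g t \<omega>))\<^sup>2))
      \<le> k / 2 * msq t + D" for t
  proof -
    let ?p = "expectation (\<lambda>\<omega>. norm (x t \<omega>) * norm (g t \<omega>))"
    have "expectation (\<lambda>\<omega>. x t \<omega> \<bullet> g t \<omega>) \<le> ?p"
      by (intro integral_mono inner_integrable xg_integrable x_meas g_meas norm_cauchy_schwarz)
    then have 1: "2 * h * expectation (\<lambda>\<omega>. x t \<omega> \<bullet> g t \<omega>) \<le> 2 * h * ?p"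
      using h_nonneg by (intro mult_left_mono) auto
    have "c / (real t + 1) * (?p + expectation (\<lambda>\<omega>. (norm (g t \<omega>))\<^sup>2)) \<le> c / 1 * (?p + G)"
      using c_nonneg g_variance[of t]
      by (intro mult_mono divide_left_mono add_left_mono add_nonneg_nonneg integral_nonneg) auto
    with 1 have "2 * h * expectation (\<lambda>\<omega>. x t \<omega> \<bullet> g t \<omega>) + c / (real t + 1) *
      (?p + expectation (\<lambda>\<omega>. (norm (g t \<omega>))\<^sup>2)) \<le> (2 * h + c) * ?p + c * G"
      by (simp add: algebra_simps)
    also have "\<dots> \<le> (2 * h + c) * (\<delta> * msq t + G / \<delta>) + c * G"
      using h_nonneg c_nonneg by (intro add_right_mono mult_left_mono prod) auto
    also have "\<dots> = (2 * h + c) * \<delta> * msq t + D" by (simp only: D_def distrib_left mult.assoc add.assoc)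
    also have "\<dots> \<le> k / 2 * msq t + D"
      by (intro add_right_mono mult_right_mono hc\<delta> msq_nonneg)
    finally show ?thesis .
  qed
  \<comment> \<open>The first summand absorbs the initial energy, the second the constant work per step.\<close>
  define K where "K = s * msq 0 / k + 2 * D / k"
  have K: "0 \<le> K" "s * msq 0 \<le> k * K" "2 * D \<le> k * K"
    using D k_pos s_nonneg msq_nonneg[of 0] by (auto simp: K_def distrib_left)
  have "msq T \<le> K" for T
  proof (induction T rule: less_induct)
    case (less T)
    have "(\<Sum>t<T. 2 * h * expectation (\<lambda>\<omega>. x t \<omega> \<bullet> g t \<omega>) + c / (real t + 1) *
      (expectation (\<lambda>\<omega>. norm (x t \<omega>) * norm (g t \<omega>)) + expectation (\<lambda>\<omega>. (norm (g t \<omega>))\<^sup>2)))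
      \<le> (\<Sum>t<T. k * K)"
    proof (rule sum_mono)
      fix t assume "t \<in> {..<T}"
      then have "k / 2 * msq t \<le> k / 2 * K" using less k_pos by (intro mult_left_mono) auto
      with summand[of t] K(3) show "2 * h * expectation (\<lambda>\<omega>. x t \<omega> \<bullet> g t \<omega>) + c / (real t + 1) *
        (expectation (\<lambda>\<omega>. norm (x t \<omega>) * norm (g t \<omega>)) + expectation (\<lambda>\<omega>. (norm (g t \<omega>))\<^sup>2)) \<le> k * K"
        by linarith
    qed
    then have "k * (real T + 1) * msq T \<le> k * (real T + 1) * K"
      using energy_expectation[of T] K(2) by (simp add: algebra_simps)
    then show ?case using k_pos by (simp add: mult_le_cancel_left_pos)
  qed
  with K(1) show thesis using that by blast
qed

lemma increment_expectation:
  assumes x1: "\<And>t. expectation (\<lambda>\<omega>. norm (x t \<omega>)) + expectation (\<lambda>\<omega>. norm (g t \<omega>)) \<le> K2"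
  shows "integrable M (\<lambda>\<omega>. norm (x (r + d) \<omega> - x r \<omega>))"
    and "expectation (\<lambda>\<omega>. norm (x (r + d) \<omega> - x r \<omega>)) \<le> real d * (L * K2 / (real r + 1))"
proof -
  have int: "integrable M (\<lambda>\<omega>. norm (x a \<omega> - x b \<omega>))" for a b
  proof (rule Bochner_Integration.integrable_bound)
    show "integrable M (\<lambda>\<omega>. norm (x a \<omega>) + norm (x b \<omega>))" using x_integrable by simp
    show "AE \<omega> in M. norm (norm (x a \<omega> - x b \<omega>)) \<le> norm (norm (x a \<omega>) + norm (x b \<omega>))"
      by (intro AE_I2) (simp add: norm_triangle_ineq4)
  qed simp
  then show "integrable M (\<lambda>\<omega>. norm (x (r + d) \<omega> - x r \<omega>))" .
  have K2: "0 \<le> K2"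
    using x1[of 0] by (rule order_trans[rotated]) simp
  have step: "expectation (\<lambda>\<omega>. norm (x (Suc t) \<omega> - x t \<omega>)) \<le> L * K2 / (real t + 1)" for t
  proof -
    have "expectation (\<lambda>\<omega>. norm (x (Suc t) \<omega> - x t \<omega>)) \<le>
        expectation (\<lambda>\<omega>. L / (real t + 1) * (norm (x t \<omega>) + norm (g t \<omega>)))"
      using increment[of t] x_integrable g_integrable
      by (intro integral_mono_AE int integrable_mult_right) (auto simp: g_def)
    also have "\<dots> = L / (real t + 1) * (expectation (\<lambda>\<omega>. norm (x t \<omega>)) + expectation (\<lambda>\<omega>. norm (g t \<omega>)))"
      using x_integrable g_integrable by simp
    also have "\<dots> \<le> L / (real t + 1) * K2"
      using L_nonneg by (intro mult_left_mono x1) auto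
    finally show ?thesis by simp
  qed
  show "expectation (\<lambda>\<omega>. norm (x (r + d) \<omega> - x r \<omega>)) \<le> real d * (L * K2 / (real r + 1))"
  proof (induction d)
    case (Suc d)
    have "expectation (\<lambda>\<omega>. norm (x (r + Suc d) \<omega> - x r \<omega>)) \<le>
        expectation (\<lambda>\<omega>. norm (x (Suc (r + d)) \<omega> - x (r + d) \<omega>) + norm (x (r + d) \<omega> - x r \<omega>))"
      by (intro integral_mono int Bochner_Integration.integrable_add)
        (simp add: order_trans[OF _ norm_triangle_ineq])
    also have "\<dots> = expectation (\<lambda>\<omega>. norm (x (Suc (r + d)) \<omega> - x (r + d) \<omega>)) +
        expectation (\<lambda>\<omega>. norm (x (r + d) \<omega> - x r \<omega>))"
      by (intro Bochner_Integration.integral_add int)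
    also have "\<dots> \<le> L * K2 / (real (r + d) + 1) + real d * (L * K2 / (real r + 1))"
      by (intro add_mono step Suc)
    also have "\<dots> \<le> L * K2 / (real r + 1) + real d * (L * K2 / (real r + 1))"
      using L_nonneg K2 by (intro add_right_mono divide_left_mono) auto
    finally show ?case by (simp add: distrib_right add_divide_distrib)
  qed simp
qed

lemma drift_expectation:
  assumes noise_uncorrelated: "expectation (\<lambda>\<omega>. x t \<omega> \<bullet> noise t \<omega>) = 0"
  shows "expectation (\<lambda>\<omega>. x t \<omega> \<bullet> g t \<omega>) = - expectation (\<lambda>\<omega>. x t \<omega> \<bullet> bias t \<omega>)"
proof -
  have b: "integrable M (\<lambda>\<omega>. x t \<omega> \<bullet> bias t \<omega>)" by (rule bias_integrable(1)[OF x_meas x_integrable])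
  have "integrable M (\<lambda>\<omega>. x t \<omega> \<bullet> g t \<omega> + x t \<omega> \<bullet> bias t \<omega>)"
    by (intro Bochner_Integration.integrable_add b inner_integrable xg_integrable x_meas g_meas)
  then have "integrable M (\<lambda>\<omega>. x t \<omega> \<bullet> noise t \<omega>)" by (simp add: g_def inner_diff_right)
  with b show ?thesis using noise_uncorrelated by (simp add: g_def inner_diff_right)
qed

text \<open>
  Insert the uniform bound on the mean squares back into the energy estimate. At times \<open>t \<le> d\<close> the
  bias is estimated trivially, at a cost proportional to \<open>d\<close>. At later times the error is split into
  its value at \<open>t - d\<close>, on which the bias acts only with strength \<open>\<epsilon>\<close>, and the increment since then.
\<close>

lemma mean_square_rate:
  assumes noise_uncorrelated: "\<And>t. expectation (\<lambda>\<omega>. x t \<omega> \<bullet> noise t \<omega>) = 0"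
    and v: "0 \<le> v"
  obtains D where "0 \<le> D" "\<And>\<epsilon> d T. 0 < \<epsilon> \<Longrightarrow> 1 \<le> d \<Longrightarrow> 1 \<le> T \<Longrightarrow>
    (\<And>r. 1 \<le> r \<Longrightarrow> \<bar>expectation (\<lambda>\<omega>. x r \<omega> \<bullet> bias (r + d) \<omega>)\<bar> \<le> \<epsilon> * v * expectation (\<lambda>\<omega>. norm (x r \<omega>)))
    \<Longrightarrow> msq T \<le> D * (\<epsilon> + real d * (1 + ln (real T)) / real T)"
proof -
  obtain K where K: "0 \<le> K" "\<And>t. msq t \<le> K" using msq_bounded by blast
  define K1 where "K1 = 1 + K"
  define K2 where "K2 = K1 + (1 + G)"
  have x1: "expectation (\<lambda>\<omega>. norm (x t \<omega>)) \<le> K1" for t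
  proof -
    have "expectation (\<lambda>\<omega>. norm (x t \<omega>)) \<le> expectation (\<lambda>\<omega>. 1 + (norm (x t \<omega>))\<^sup>2)"
      using x_moment by (intro integral_mono x_integrable norm_le_one_plus_square) auto
    also have "\<dots> = 1 + msq t" using x_moment by (simp add: msq_def prob_space)
    finally show ?thesis using K(2)[of t] by (simp add: K1_def)
  qed
  have g1: "expectation (\<lambda>\<omega>. norm (g t \<omega>)) \<le> 1 + G" for t
  proof -
    have "expectation (\<lambda>\<omega>. norm (g t \<omega>)) \<le> expectation (\<lambda>\<omega>. 1 + (norm (g t \<omega>))\<^sup>2)"
      using g_moment by (intro integral_mono g_integrable norm_le_one_plus_square) auto
    also have "\<dots> = 1 + expectation (\<lambda>\<omega>. (norm (g t \<omega>))\<^sup>2)" using g_moment by (simp add: prob_space)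
    finally show ?thesis using g_variance[of t] by simp
  qed
  have xg1: "expectation (\<lambda>\<omega>. norm (x t \<omega>)) + expectation (\<lambda>\<omega>. norm (g t \<omega>)) \<le> K2" for t
    using x1[of t] g1[of t] by (simp add: K2_def)
  have nn: "0 \<le> K1" "0 \<le> K2" using K G_nonneg by (auto simp: K1_def K2_def)
  have prod: "expectation (\<lambda>\<omega>. norm (x t \<omega>) * norm (g t \<omega>)) \<le> K + G" for t
  proof -
    have "expectation (\<lambda>\<omega>. norm (x t \<omega>) * norm (g t \<omega>)) \<le>
        expectation (\<lambda>\<omega>. ((norm (x t \<omega>))\<^sup>2 + (norm (g t \<omega>))\<^sup>2) / 2)"
      using x_moment g_moment by (intro integral_mono xg_integrable norm_mult_le_sum_squares) auto
    also have "\<dots> = (msq t + expectation (\<lambda>\<omega>. (norm (g t \<omega>))\<^sup>2)) / 2"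
      using x_moment g_moment by (simp add: msq_def)
    finally show ?thesis using K(2)[of t] g_variance[of t] K(1) G_nonneg by simp
  qed
  \<comment> \<open>The terms collect, in this order: initial energy, early times, conditional bias, increments over
    the delay, and the second-order terms of the energy.\<close>
  define D where "D = s * K + 2 * h * (2 * \<beta> * K1 + v * K1 + \<beta> * L * K2) + c * (K + 2 * G)"
  have D_nonneg: "0 \<le> D"
    unfolding D_def using s_nonneg h_nonneg \<beta>_nonneg c_nonneg L_nonneg v nn K(1) G_nonneg
    by (intro add_nonneg_nonneg mult_nonneg_nonneg) auto
  have rate: "msq T \<le> D / k * (\<epsilon> + real d * (1 + ln (real T)) / real T)"
    if \<epsilon>: "0 < \<epsilon>" and d: "1 \<le> d" and T: "1 \<le> T"
      and delay: "\<And>r. 1 \<le> r \<Longrightarrow>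
        \<bar>expectation (\<lambda>\<omega>. x r \<omega> \<bullet> bias (r + d) \<omega>)\<bar> \<le> \<epsilon> * v * expectation (\<lambda>\<omega>. norm (x r \<omega>))"
    for \<epsilon> d T
  proof -
    define q where "q t = (if t \<le> d then 0 else 1 / (real (t - d) + 1))" for t
    have drift: "expectation (\<lambda>\<omega>. x t \<omega> \<bullet> g t \<omega>) \<le>
        (if t \<le> d then \<beta> * K1 else 0) + \<epsilon> * v * K1 + real d * (\<beta> * L * K2) * q t" for t
    proof (cases "t \<le> d")
      case True
      have "\<bar>expectation (\<lambda>\<omega>. x t \<omega> \<bullet> bias t \<omega>)\<bar> \<le> \<beta> * expectation (\<lambda>\<omega>. norm (x t \<omega>))"
        by (rule bias_integrable(2)[OF x_meas x_integrable])
      also have "\<dots> \<le> \<beta> * K1" using \<beta>_nonneg by (intro mult_left_mono x1)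
      finally have "expectation (\<lambda>\<omega>. x t \<omega> \<bullet> g t \<omega>) \<le> \<beta> * K1" by (simp add: drift_expectation[OF noise_uncorrelated])
      moreover have "0 \<le> \<epsilon> * v * K1" using \<epsilon> v nn by simp
      ultimately show ?thesis using True by (simp add: q_def)
    next
      case False
      define r where "r = t - d"
      have t: "t = r + d" and r: "1 \<le> r" using False by (auto simp: r_def)
      have split: "expectation (\<lambda>\<omega>. x t \<omega> \<bullet> bias t \<omega>) =
          expectation (\<lambda>\<omega>. (x t \<omega> - x r \<omega>) \<bullet> bias t \<omega>) + expectation (\<lambda>\<omega>. x r \<omega> \<bullet> bias t \<omega>)"
        using bias_integrable(1)[OF x_meas x_integrable] by (simp add: inner_diff_left)
      have "\<bar>expectation (\<lambda>\<omega>. (x t \<omega> - x r \<omega>) \<bullet> bias t \<omega>)\<bar> \<le> \<beta> * expectation (\<lambda>\<omega>. norm (x t \<omega> - x r \<omega>))"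
        unfolding t by (intro bias_integrable(2) increment_expectation(1)[OF xg1]) measurable
      also have "\<dots> \<le> \<beta> * (real d * (L * K2 / (real r + 1)))"
        using increment_expectation(2)[OF xg1, of r d] \<beta>_nonneg unfolding t by (intro mult_left_mono)
      also have "\<dots> = real d * (\<beta> * L * K2) * q t"
        using r t d by (simp add: q_def)
      finally have 1: "\<bar>expectation (\<lambda>\<omega>. (x t \<omega> - x r \<omega>) \<bullet> bias t \<omega>)\<bar> \<le> real d * (\<beta> * L * K2) * q t" .
      have "\<bar>expectation (\<lambda>\<omega>. x r \<omega> \<bullet> bias t \<omega>)\<bar> \<le> \<epsilon> * v * expectation (\<lambda>\<omega>. norm (x r \<omega>))"
        unfolding t by (rule delay[OF r])
      also have "\<dots> \<le> \<epsilon> * v * K1" using \<epsilon> v by (intro mult_left_mono x1) auto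
      finally have "\<bar>expectation (\<lambda>\<omega>. x r \<omega> \<bullet> bias t \<omega>)\<bar> \<le> \<epsilon> * v * K1" .
      with 1 False show ?thesis unfolding drift_expectation[OF noise_uncorrelated] split by simp
    qed
    define H where "H = 1 + ln (real T)"
    have H: "1 \<le> H" "harm T \<le> H" using T harm_le_one_plus_ln[OF T] by (auto simp: H_def)
    have sum_q: "(\<Sum>t<T. q t) \<le> H"
      using sum_shifted_harmonic[of d T] H(2) unfolding q_def by linarith
    have sum_early: "(\<Sum>t<T. if t \<le> d then \<beta> * K1 else 0) \<le> 2 * real d * (\<beta> * K1)"
    proof -
      have "(\<Sum>t<T. if t \<le> d then \<beta> * K1 else 0) = (\<Sum>t\<in>{..<T} \<inter> {..d}. \<beta> * K1)"
        by (simp add: sum.If_cases atMost_def)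
      also have "\<dots> = real (card ({..<T} \<inter> {..d})) * (\<beta> * K1)" by simp
      also have "\<dots> \<le> (2 * real d) * (\<beta> * K1)"
      proof (rule mult_right_mono)
        have "card ({..<T} \<inter> {..d}) \<le> card {..d}" by (intro card_mono) auto
        then show "real (card ({..<T} \<inter> {..d})) \<le> 2 * real d" using d by simp
      qed (use \<beta>_nonneg nn in simp)
      finally show ?thesis .
    qed
    have "(\<Sum>t<T. 2 * h * expectation (\<lambda>\<omega>. x t \<omega> \<bullet> g t \<omega>)) \<le>
        2 * h * (\<Sum>t<T. (if t \<le> d then \<beta> * K1 else 0) + \<epsilon> * v * K1 + real d * (\<beta> * L * K2) * q t)"
      unfolding sum_distrib_left using h_nonneg by (intro sum_mono mult_left_mono drift) auto
    also have "(\<Sum>t<T. (if t \<le> d then \<beta> * K1 else 0) + \<epsilon> * v * K1 + real d * (\<beta> * L * K2) * q t) =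
        (\<Sum>t<T. if t \<le> d then \<beta> * K1 else 0) + real T * (\<epsilon> * v * K1) + real d * (\<beta> * L * K2) * (\<Sum>t<T. q t)"
      by (simp add: sum.distrib sum_distrib_left)
    also have "2 * h * \<dots> \<le> 2 * h * (2 * real d * (\<beta> * K1) + real T * (\<epsilon> * v * K1) + real d * (\<beta> * L * K2) * H)"
      using h_nonneg \<beta>_nonneg L_nonneg nn by (intro mult_left_mono add_mono sum_early sum_q order_refl) auto
    finally have S1: "(\<Sum>t<T. 2 * h * expectation (\<lambda>\<omega>. x t \<omega> \<bullet> g t \<omega>)) \<le>
      2 * h * (2 * real d * (\<beta> * K1) + real T * (\<epsilon> * v * K1) + real d * (\<beta> * L * K2) * H)" .
    have "(\<Sum>t<T. c / (real t + 1) * (expectation (\<lambda>\<omega>. norm (x t \<omega>) * norm (g t \<omega>)) +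
        expectation (\<lambda>\<omega>. (norm (g t \<omega>))\<^sup>2))) \<le> (\<Sum>t<T. c / (real t + 1) * (K + 2 * G))"
    proof (intro sum_mono mult_left_mono)
      show "expectation (\<lambda>\<omega>. norm (x t \<omega>) * norm (g t \<omega>)) + expectation (\<lambda>\<omega>. (norm (g t \<omega>))\<^sup>2) \<le> K + 2 * G" for t
        using prod[of t] g_variance[of t] by simp
    qed (use c_nonneg in simp)
    also have "\<dots> = c * (K + 2 * G) * harm T"
      by (simp add: harm_altdef sum_distrib_left divide_inverse mult_ac add.commute)
    also have "\<dots> \<le> c * (K + 2 * G) * H"
      using c_nonneg K(1) G_nonneg by (intro mult_left_mono H) auto
    finally have S2: "(\<Sum>t<T. c / (real t + 1) * (expectation (\<lambda>\<omega>. norm (x t \<omega>) * norm (g t \<omega>)) +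
        expectation (\<lambda>\<omega>. (norm (g t \<omega>))\<^sup>2))) \<le> c * (K + 2 * G) * H" .
    define X where "X = real T * \<epsilon> + real d * H"
    have dH: "1 \<le> real d * H" "real d \<le> real d * H" "H \<le> real d * H"
      using d H(1) mult_mono[of 1 "real d" 1 H] by (auto simp: mult_le_cancel_left1 mult_le_cancel_right1)
    have T\<epsilon>: "0 \<le> real T * \<epsilon>" using \<epsilon> by simp
    have X: "1 \<le> X" "real d \<le> X" "H \<le> X" "real d * H \<le> X" "real T * \<epsilon> \<le> X"
      using dH T\<epsilon> d unfolding X_def by linarith+
    have "k * (real T + 1) * msq T \<le> s * K +
        2 * h * (2 * real d * (\<beta> * K1) + real T * (\<epsilon> * v * K1) + real d * (\<beta> * L * K2) * H) + c * (K + 2 * G) * H"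
      using energy_expectation[of T] S1 S2 mult_left_mono[OF K(2)[of 0] s_nonneg]
      unfolding sum.distrib by linarith
    also have "\<dots> = s * K * 1 + 2 * h * (2 * \<beta> * K1 * real d + v * K1 * (real T * \<epsilon>) + \<beta> * L * K2 * (real d * H)) +
        c * (K + 2 * G) * H"
      by (simp add: mult_ac)
    also have "\<dots> \<le> s * K * X + 2 * h * (2 * \<beta> * K1 * X + v * K1 * X + \<beta> * L * K2 * X) + c * (K + 2 * G) * X"
      using s_nonneg h_nonneg \<beta>_nonneg c_nonneg L_nonneg v nn K(1) G_nonneg
      by (intro add_mono mult_left_mono X mult_nonneg_nonneg add_nonneg_nonneg) auto
    also have "\<dots> = D * X" by (simp add: D_def algebra_simps)
    finally have "k * (real T + 1) * msq T \<le> D * X" .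
    moreover have "k * real T * msq T \<le> k * (real T + 1) * msq T"
      using k_pos msq_nonneg by (intro mult_right_mono) auto
    ultimately have "msq T * (k * real T) \<le> D * X" by (simp add: mult_ac)
    then have "msq T \<le> D * X / (k * real T)" using k_pos T by (simp add: pos_le_divide_eq)
    also have "\<dots> = D / k * (\<epsilon> + real d * (1 + ln (real T)) / real T)"
      using T k_pos by (simp add: X_def H_def field_simps)
    finally show ?thesis .
  qed
  show thesis
    by (rule that[OF _ rate]) (use D_nonneg k_pos in auto)
qed

end

section \<open>Measurability, independence and conditional expectation\<close>

lemma borel_measurable_mult_vec [measurable (raw)]:
  fixes X :: "'a \<Rightarrow> real^'m^'n"
  assumes "X \<in> borel_measurable F" "y \<in> borel_measurable F"
  shows "(\<lambda>\<omega>. X \<omega> *v y \<omega>) \<in> borel_measurable F"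
  by (rule borel_measurable_continuous_Pair[OF assms])
    (auto simp: matrix_vector_mult_def intro!: continuous_intros continuous_on_vec_lambda)

lemma borel_measurable_transpose [measurable (raw)]:
  fixes X :: "'a \<Rightarrow> real^'m^'n"
  assumes "X \<in> borel_measurable F"
  shows "(\<lambda>\<omega>. transpose (X \<omega>)) \<in> borel_measurable F"
  by (rule measurable_compose[OF assms borel_measurable_continuous_onI])
    (auto simp: transpose_def intro!: continuous_intros continuous_on_vec_lambda)

lemma borel_measurable_gram [measurable (raw)]:
  fixes X :: "'a \<Rightarrow> real^'m^'n"
  assumes "X \<in> borel_measurable F"
  shows "(\<lambda>\<omega>. gram (X \<omega>)) \<in> borel_measurable F"
  by (rule measurable_compose[OF assms borel_measurable_continuous_onI])
    (auto simp: gram_def transpose_def matrix_matrix_mult_def intro!: continuous_intros continuous_on_vec_lambda)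

lemma borel_measurable_vec_component [measurable (raw)]:
  fixes X :: "'a \<Rightarrow> 'b::real_normed_vector^'n"
  assumes "X \<in> borel_measurable F"
  shows "(\<lambda>\<omega>. X \<omega> $ i) \<in> borel_measurable F"
  by (rule measurable_compose[OF assms borel_measurable_continuous_onI]) (intro continuous_intros)

lemma borel_measurable_ens_mean:
  fixes Z :: "'a \<Rightarrow> 'j::finite \<Rightarrow> real^'d"
  assumes [measurable]: "\<And>j. (\<lambda>\<omega>. Z \<omega> j) \<in> borel_measurable F"
  shows "(\<lambda>\<omega>. ens_mean (Z \<omega>)) \<in> borel_measurable F"
  unfolding ens_mean_def by measurable

lemma vimage_algebra_subset:
  assumes "X \<in> borel_measurable M"
  shows "sets (vimage_algebra (space M) X borel) \<subseteq> sets M"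
  unfolding sets_vimage_algebra
  using assms by (intro sets.sigma_sets_subset) (auto intro: measurable_sets)

lemma space_natural_filtration [simp]: "space (natural_filtration M X t) = space M"
  by (simp add: natural_filtration_def gen_sigma_def space_measure_of_conv)

lemma subalgebra_natural_filtration:
  assumes "\<And>i. X i \<in> borel_measurable M"
  shows "subalgebra M (natural_filtration M X t)"
proof -
  have "(\<Union>i\<in>{..t}. sets (vimage_algebra (space M) (X i) borel)) \<subseteq> sets M"
    using vimage_algebra_subset[OF assms] by blast
  then have "sets (natural_filtration M X t) \<subseteq> sets M"
    unfolding natural_filtration_def gen_sigma_def sets_measure_of_conv
    by (auto dest: sets.sigma_sets_subset)
  then show ?thesis by (simp add: subalgebra_def)
qed

lemma
  assumes X: "X \<in> borel_measurable M" and F: "subalgebra M F"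
  shows subalgebra_extend_sigma: "subalgebra M (extend_sigma F X)"
    and extend_sigma_measurable: "X \<in> borel_measurable (extend_sigma F X)"
    and extend_sigma_mono: "Y \<in> borel_measurable F \<Longrightarrow> Y \<in> borel_measurable (extend_sigma F X)"
proof -
  have sp: "space F = space M" and sub: "sets F \<subseteq> sets M" using F by (auto simp: subalgebra_def)
  have spE: "space (extend_sigma F X) = space M" by (simp add: extend_sigma_def space_measure_of_conv sp)
  have V: "sets (vimage_algebra (space F) X borel) \<subseteq> sets M"
    unfolding sp by (rule vimage_algebra_subset[OF X])
  have gen: "sets F \<union> sets (vimage_algebra (space F) X borel) \<subseteq> Pow (space F)"
    using V sub sets.space_closed[of M] sp by auto
  then have setsE: "sets (extend_sigma F X) = sigma_sets (space F) (sets F \<union> sets (vimage_algebra (space F) X borel))"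
    by (simp add: extend_sigma_def)
  have "sigma_sets (space M) (sets F \<union> sets (vimage_algebra (space F) X borel)) \<subseteq> sets M"
    by (rule sets.sigma_sets_subset) (use sub V in blast)
  then show "subalgebra M (extend_sigma F X)"
    by (simp add: subalgebra_def spE setsE sp)
  show "X \<in> borel_measurable (extend_sigma F X)"
    by (rule measurableI) (auto simp: setsE spE sp sets_vimage_algebra intro!: sigma_sets.Basic)
  show "Y \<in> borel_measurable (extend_sigma F X)" if "Y \<in> borel_measurable F"
    by (rule measurableI) (use measurable_sets[OF that] in \<open>auto simp: setsE spE sp intro!: sigma_sets.Basic\<close>)
qed

context prob_space
begin

text \<open>
  Independence is given for \<open>\<sigma>\<close>-algebras; it passes to the random variables because both generate
  smaller \<open>\<sigma>\<close>-algebras.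
\<close>

lemma indep_expectation_mult:
  fixes X Y :: "'a \<Rightarrow> real" and W :: "'a \<Rightarrow> 'b::topological_space"
  assumes indep: "indep_set (sets F) (sets (vimage_algebra (space M) W borel))"
    and F: "subalgebra M F" and X: "X \<in> borel_measurable F"
    and W: "W \<in> borel_measurable M" and f: "f \<in> borel_measurable borel"
    and int: "integrable M X" "integrable M (\<lambda>\<omega>. f (W \<omega>))"
  shows "integrable M (\<lambda>\<omega>. X \<omega> * f (W \<omega>))"
    and "expectation (\<lambda>\<omega>. X \<omega> * f (W \<omega>)) = expectation X * expectation (\<lambda>\<omega>. f (W \<omega>))"
proof -
  have sp: "space F = space M" using F by (simp add: subalgebra_def)
  have "{X -` B \<inter> space F |B. B \<in> sets borel} \<subseteq> sets F"
    using measurable_sets[OF X] by blast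
  then have "sigma_sets (space F) {X -` B \<inter> space F |B. B \<in> sets borel} \<subseteq> sets F"
    by (rule sets.sigma_sets_subset)
  then have 1: "sigma_sets (space M) {X -` B \<inter> space M |B. B \<in> sets borel} \<subseteq> sets F"
    unfolding sp .
  have "{(\<lambda>\<omega>. f (W \<omega>)) -` B \<inter> space M |B. B \<in> sets borel} \<subseteq> {W -` B \<inter> space M |B. B \<in> sets borel}"
  proof clarify
    fix B :: "real set" assume "B \<in> sets borel"
    then have "f -` B \<in> sets borel" using measurable_sets[OF f] by simp
    moreover have "(\<lambda>\<omega>. f (W \<omega>)) -` B \<inter> space M = W -` (f -` B) \<inter> space M" by auto
    ultimately show "\<exists>C. (\<lambda>\<omega>. f (W \<omega>)) -` B \<inter> space M = W -` C \<inter> space M \<and> C \<in> sets borel" by blast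
  qed
  then have 2: "sigma_sets (space M) {(\<lambda>\<omega>. f (W \<omega>)) -` B \<inter> space M |B. B \<in> sets borel} \<subseteq>
      sets (vimage_algebra (space M) W borel)"
    unfolding sets_vimage_algebra by (rule sigma_sets_mono')
  have "indep_var borel X borel (\<lambda>\<omega>. f (W \<omega>))"
    unfolding indep_var_eq
  proof (intro conjI)
    show "random_variable borel X" by (rule measurable_from_subalg[OF F X])
    show "random_variable borel (\<lambda>\<omega>. f (W \<omega>))" by (rule measurable_compose[OF W f])
    show "indep_set (sigma_sets (space M) {X -` B \<inter> space M |B. B \<in> sets borel})
      (sigma_sets (space M) {(\<lambda>\<omega>. f (W \<omega>)) -` B \<inter> space M |B. B \<in> sets borel})"
      using indep 1 2 unfolding indep_sets2_eq by blast
  qed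
  then show "integrable M (\<lambda>\<omega>. X \<omega> * f (W \<omega>))"
    and "expectation (\<lambda>\<omega>. X \<omega> * f (W \<omega>)) = expectation X * expectation (\<lambda>\<omega>. f (W \<omega>))"
    using int by (rule indep_var_integrable, rule indep_var_lebesgue_integral)
qed

text \<open>
  Moving \<open>S\<close> to the other side gives \<open>(S X) \<bullet> W\<close>, whose left factor is measurable with respect to
  \<open>F\<close> and therefore independent of \<open>W\<close>.
\<close>

lemma observation_noise_uncorrelated:
  fixes X :: "'a \<Rightarrow> real^'d" and S :: "'a \<Rightarrow> real^'d^'p" and W :: "'a \<Rightarrow> real^'p"
  assumes indep: "indep_set (sets F) (sets (vimage_algebra (space M) W borel))"
    and F: "subalgebra M F" and X: "X \<in> borel_measurable F" and S: "S \<in> borel_measurable F"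
    and W: "W \<in> borel_measurable M"
    and X2: "integrable M (\<lambda>\<omega>. (norm (X \<omega>))\<^sup>2)" and W2: "integrable M (\<lambda>\<omega>. (norm (W \<omega>))\<^sup>2)"
    and centred: "\<And>i. expectation (\<lambda>\<omega>. W \<omega> $ i) = 0"
    and S_bound: "AE \<omega> in M. op_norm (gram (S \<omega>)) \<le> a" and a: "0 \<le> a"
  shows "expectation (\<lambda>\<omega>. X \<omega> \<bullet> (transpose (S \<omega>) *v W \<omega>)) = 0"
proof -
  note [measurable] = measurable_from_subalg[OF F X] measurable_from_subalg[OF F S] W
  have SX: "(\<lambda>\<omega>. (S \<omega> *v X \<omega>) $ i) \<in> borel_measurable F" for i
    using X S by measurable
  have SX_int: "integrable M (\<lambda>\<omega>. (S \<omega> *v X \<omega>) $ i)" for i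
  proof (rule Bochner_Integration.integrable_bound)
    show "integrable M (\<lambda>\<omega>. sqrt a * norm (X \<omega>))"
      using integrable_norm_of_moment[OF _ X2] by simp
    show "AE \<omega> in M. norm ((S \<omega> *v X \<omega>) $ i) \<le> norm (sqrt a * norm (X \<omega>))"
      using S_bound
    proof eventually_elim
      case (elim \<omega>)
      then show ?case
        using component_le_norm_cart[of "S \<omega> *v X \<omega>" i] norm_factor_le[OF elim a, of "X \<omega>"] a
        by simp
    qed
  qed measurable
  have W_int: "integrable M (\<lambda>\<omega>. W \<omega> $ i)" for i
    by (rule Bochner_Integration.integrable_bound[OF integrable_norm_of_moment[OF W W2]])
      (use component_le_norm_cart in auto)
  have component: "(\<lambda>y::real^'p. y $ i) \<in> borel_measurable borel" for i
    by measurable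
  note prod = indep_expectation_mult[OF indep F SX W component SX_int W_int]
  have "X \<omega> \<bullet> (transpose (S \<omega>) *v W \<omega>) = (S \<omega> *v X \<omega>) \<bullet> W \<omega>" for \<omega>
    by (metis transpose_inner inner_commute)
  then have "expectation (\<lambda>\<omega>. X \<omega> \<bullet> (transpose (S \<omega>) *v W \<omega>)) =
      expectation (\<lambda>\<omega>. \<Sum>i\<in>UNIV. (S \<omega> *v X \<omega>) $ i * W \<omega> $ i)"
    by (simp add: inner_vec_def)
  also have "\<dots> = (\<Sum>i\<in>UNIV. expectation (\<lambda>\<omega>. (S \<omega> *v X \<omega>) $ i * W \<omega> $ i))"
    by (rule Bochner_Integration.integral_sum) (rule prod(1))
  also have "\<dots> = 0" by (simp add: prod(2) centred)
  finally show ?thesis .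
qed

text \<open>
  The defining property of conditional expectation, applied to each matrix entry separately.
\<close>

lemma matrix_cond_exp_inner:
  fixes X :: "'a \<Rightarrow> real^'d" and R :: "'a \<Rightarrow> real^'d^'d"
  assumes F: "subalgebra M F" and X: "X \<in> borel_measurable F" and R: "R \<in> borel_measurable M"
    and X2: "integrable M (\<lambda>\<omega>. (norm (X \<omega>))\<^sup>2)"
    and R_bound: "AE \<omega> in M. op_norm (R \<omega>) \<le> a"
  shows "integrable M (\<lambda>\<omega>. X \<omega> \<bullet> ((matrix_cond_exp M F R \<omega> - A) *v v))"
    and "expectation (\<lambda>\<omega>. X \<omega> \<bullet> ((R \<omega> - A) *v v)) =
      expectation (\<lambda>\<omega>. X \<omega> \<bullet> ((matrix_cond_exp M F R \<omega> - A) *v v))"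
proof -
  interpret finite_measure_subalgebra M F by unfold_locales (rule F)
  note [measurable] = measurable_from_subalg[OF F X] R
  have Xn: "integrable M (\<lambda>\<omega>. norm (X \<omega>))"
    by (rule integrable_norm_of_moment[OF _ X2]) measurable
  have Xi: "(\<lambda>\<omega>. X \<omega> $ i) \<in> borel_measurable F" for i using X by measurable
  have X_int: "integrable M (\<lambda>\<omega>. X \<omega> $ i)" for i
    by (rule Bochner_Integration.integrable_bound[OF Xn])
      (use component_le_norm_cart in auto)
  have XR: "integrable M (\<lambda>\<omega>. X \<omega> $ i * R \<omega> $ i $ l)" for i l
  proof (rule Bochner_Integration.integrable_bound)
    show "integrable M (\<lambda>\<omega>. a * norm (X \<omega>))" using Xn by simp
    show "AE \<omega> in M. norm (X \<omega> $ i * R \<omega> $ i $ l) \<le> norm (a * norm (X \<omega>))"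
      using R_bound
    proof eventually_elim
      case (elim \<omega>)
      have "\<bar>R \<omega> $ i $ l\<bar> \<le> \<bar>a\<bar>"
        using matrix_component_le_onorm[of "R \<omega>" i l] elim by (simp add: op_norm_def)
      then have "\<bar>R \<omega> $ i $ l\<bar> * \<bar>X \<omega> $ i\<bar> \<le> \<bar>a\<bar> * norm (X \<omega>)"
        by (intro mult_mono component_le_norm_cart) auto
      then show ?case by (simp add: abs_mult mult.commute)
    qed
  qed measurable
  note ce = real_cond_exp_intg[OF XR Xi]
  have ce_int: "integrable M (\<lambda>\<omega>. X \<omega> $ i * matrix_cond_exp M F R \<omega> $ i $ l)" for i l
    using ce(1)[of i l] by (simp add: matrix_cond_exp_def)
  have ce_eq: "expectation (\<lambda>\<omega>. X \<omega> $ i * matrix_cond_exp M F R \<omega> $ i $ l) =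
      expectation (\<lambda>\<omega>. X \<omega> $ i * R \<omega> $ i $ l)" for i l
    using ce(2)[of i l] by (simp add: matrix_cond_exp_def)
  have expand: "X \<omega> \<bullet> ((Y - A) *v v) =
      (\<Sum>i\<in>UNIV. \<Sum>l\<in>UNIV. (X \<omega> $ i * Y $ i $ l) * v $ l - X \<omega> $ i * (A $ i $ l * v $ l))" for \<omega> Y
    by (simp add: inner_vec_def matrix_vector_mult_def sum_distrib_left algebra_simps)
  show "integrable M (\<lambda>\<omega>. X \<omega> \<bullet> ((matrix_cond_exp M F R \<omega> - A) *v v))"
    unfolding expand using ce_int X_int
    by (intro Bochner_Integration.integrable_sum Bochner_Integration.integrable_diff integrable_mult_left)
  show "expectation (\<lambda>\<omega>. X \<omega> \<bullet> ((R \<omega> - A) *v v)) =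
      expectation (\<lambda>\<omega>. X \<omega> \<bullet> ((matrix_cond_exp M F R \<omega> - A) *v v))"
    unfolding expand
    by (simp add: Bochner_Integration.integral_sum Bochner_Integration.integral_diff
        Bochner_Integration.integrable_sum Bochner_Integration.integrable_diff
        XR X_int ce_int ce_eq)
qed

text \<open>
  Conditioning on \<open>F\<close>, with respect to which \<open>X\<close> is known, replaces the random matrix by its
  conditional mean; this is how ergodicity in conditional mean controls a bias that need not be
  small pathwise.
\<close>

lemma delayed_bias_bound:
  fixes X :: "'a \<Rightarrow> real^'d" and R :: "'a \<Rightarrow> real^'d^'d"
  assumes F: "subalgebra M F" and X: "X \<in> borel_measurable F" and R: "R \<in> borel_measurable M"
    and X2: "integrable M (\<lambda>\<omega>. (norm (X \<omega>))\<^sup>2)"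
    and R_bound: "AE \<omega> in M. op_norm (R \<omega>) \<le> a"
    and close: "AE \<omega> in M. op_norm (matrix_cond_exp M F R \<omega> - A) \<le> \<epsilon>"
  shows "\<bar>expectation (\<lambda>\<omega>. X \<omega> \<bullet> ((R \<omega> - A) *v v))\<bar> \<le> \<epsilon> * norm v * expectation (\<lambda>\<omega>. norm (X \<omega>))"
proof -
  note [measurable] = measurable_from_subalg[OF F X]
  note ce = matrix_cond_exp_inner[OF F X R X2 R_bound, of A v]
  have Xn: "integrable M (\<lambda>\<omega>. norm (X \<omega>))"
    by (rule integrable_norm_of_moment[OF _ X2]) measurable
  have "\<bar>expectation (\<lambda>\<omega>. X \<omega> \<bullet> ((R \<omega> - A) *v v))\<bar> \<le>
      expectation (\<lambda>\<omega>. \<bar>X \<omega> \<bullet> ((matrix_cond_exp M F R \<omega> - A) *v v)\<bar>)"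
    unfolding ce(2) by (rule integral_abs_bound)
  also have "\<dots> \<le> expectation (\<lambda>\<omega>. \<epsilon> * norm v * norm (X \<omega>))"
  proof (rule integral_mono_AE)
    show "AE \<omega> in M. \<bar>X \<omega> \<bullet> ((matrix_cond_exp M F R \<omega> - A) *v v)\<bar> \<le> \<epsilon> * norm v * norm (X \<omega>)"
      using close
    proof eventually_elim
      case (elim \<omega>)
      let ?y = "(matrix_cond_exp M F R \<omega> - A) *v v"
      have "norm ?y \<le> \<epsilon> * norm v"
        using op_norm_bound[of "matrix_cond_exp M F R \<omega> - A" v] mult_right_mono[OF elim norm_ge_zero[of v]]
        by linarith
      then have "norm (X \<omega>) * norm ?y \<le> norm (X \<omega>) * (\<epsilon> * norm v)" by (intro mult_left_mono) auto
      then show ?case using Cauchy_Schwarz_ineq2[of "X \<omega>" ?y] by (simp add: mult_ac)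
    qed
  qed (use ce(1) Xn in auto)
  finally show ?thesis using Xn by simp
qed

end

section \<open>Convergence of the ensemble mean\<close>

text \<open>
  The energy dominates the initial covariance, so the bound on the step size makes \<open>h C\<close> at most
  \<open>\<alpha> / (a + \<alpha>)\<^sup>2\<close> initially. An ensemble of zero energy is excluded, because it would force \<open>h \<le> 0\<close>.
\<close>

lemma deki_pathwise:
  fixes z :: "nat \<Rightarrow> 'j::finite \<Rightarrow> real^'d" and S :: "nat \<Rightarrow> real^'d^'p"
    and \<alpha> h :: real
  defines "C \<equiv> \<lambda>t y. ens_cov (z t) *v y" and "B \<equiv> \<lambda>t. reg_gram (S (Suc t)) \<alpha>"
  assumes step: "\<And>t. z (Suc t) = deki_step \<alpha> h (S (Suc t)) (S (Suc t) *v zs + w (Suc t)) (z t)"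
    and data: "\<And>t. op_norm (gram (S t)) \<le> a" "0 < a"
    and \<alpha>: "0 < \<alpha>" and h: "0 < h"
    and small: "h \<le> min (\<alpha> / (real CARD('j) * (a + \<alpha>)^2)) (real CARD('j) / \<alpha>) * inverse (ens_energy (z 0))"
  shows "riccati_recursion C B h \<alpha> (a + \<alpha>)"
proof (rule riccati_recursion.intro)
  show "linear (C t)" for t unfolding C_def by simp
  show "C t p \<bullet> y = p \<bullet> C t y" for t p y unfolding C_def by (rule ens_cov_symmetric)
  show "0 \<le> y \<bullet> C t y" for t y unfolding C_def by (rule ens_cov_psd)
  show "linear (B t)" for t unfolding B_def by (rule linear_reg_gram)
  show "B t p \<bullet> y = p \<bullet> B t y" for t p y unfolding B_def by (rule reg_gram_symmetric)
  show "\<alpha> * (norm y)\<^sup>2 \<le> y \<bullet> B t y" for t y unfolding B_def by (rule reg_gram_lower)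
  show "norm (B t y) \<le> (a + \<alpha>) * norm y" for t y
    unfolding B_def using data \<alpha> by (intro reg_gram_upper) auto
  show "0 < h" "0 < \<alpha>" "\<alpha> < a + \<alpha>" using h \<alpha> data by auto
  show "C (Suc t) y = C t (y - h *\<^sub>R B t (C t y) - h *\<^sub>R B t (C t (y - h *\<^sub>R B t (C t y))))" for t y
    unfolding C_def B_def step by (rule ens_cov_deki_step)
  show "h * (y \<bullet> C 0 y) \<le> \<alpha> / (a + \<alpha>)\<^sup>2 * (norm y)\<^sup>2" for y
  proof -
    let ?E = "ens_energy (z 0)" and ?q = "\<alpha> / (real CARD('j) * (a + \<alpha>)\<^sup>2)"
    have E: "0 < ?E"
      using small h ens_energy_nonneg[of "z 0"] by (cases "?E = 0") auto
    have "h \<le> ?q * inverse ?E"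
      using small E by (intro order_trans[OF small] mult_right_mono) auto
    then have "h * ?E \<le> ?q * inverse ?E * ?E" using E by (intro mult_right_mono) auto
    also have "\<dots> = ?q" using E by simp
    also have "?q \<le> \<alpha> / (1 * (a + \<alpha>)\<^sup>2)"
    proof (intro divide_left_mono mult_right_mono)
      show "1 \<le> real CARD('j)" by (simp add: Suc_leI)
    qed (use \<alpha> data in \<open>auto simp: add_pos_pos\<close>)
    finally have hE: "h * ?E \<le> \<alpha> / (a + \<alpha>)\<^sup>2" by simp
    have "h * (y \<bullet> C 0 y) \<le> h * (?E * (norm y)\<^sup>2)"
      unfolding C_def using h by (intro mult_left_mono ens_cov_le_energy) auto
    also have "\<dots> \<le> \<alpha> / (a + \<alpha>)\<^sup>2 * (norm y)\<^sup>2"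
      using mult_right_mono[OF hE, of "(norm y)\<^sup>2"] by (simp add: mult.assoc)
    finally show ?thesis .
  qed
qed

text \<open>
  Combines the pathwise energy bound, valid on the almost sure event where all data matrices are
  bounded, with the abstract rate for error processes.
\<close>

lemma deki_mean_square_rate:
  fixes M :: "'a measure"
    and S :: "nat \<Rightarrow> 'a \<Rightarrow> real^'d^'p"
    and w :: "nat \<Rightarrow> 'a \<Rightarrow> real^'p"
    and z :: "nat \<Rightarrow> 'a \<Rightarrow> 'j::finite \<Rightarrow> real^'d"
    and zs :: "real^'d" and A :: "real^'d^'d" and \<alpha> :: real
  defines "u \<equiv> observation S zs w"
  defines "x \<equiv> \<lambda>t \<omega>. ens_mean (z t \<omega>) - z_opt A \<alpha> zs"
  assumes model: "observation_model M S zs w \<Gamma>"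
    and A_max: "0 < A_max" "\<And>t. AE \<omega> in M. op_norm (gram (S t \<omega>)) \<le> A_max"
    and \<alpha>: "0 < \<alpha>"
    and ergodic: "ergodic_data M (natural_filtration M u) S A \<tau>"
    and h: "0 < h"
    and deki: "is_deki M \<alpha> (\<lambda>_. h) S u z"
    and init_moment: "\<And>j. integrable M (\<lambda>\<omega>. (norm (z 0 \<omega> j))^2)"
    and \<sigma>l: "0 < \<sigma>l" "AE \<omega> in M. loewner_less (mat \<sigma>l) (ens_cov (z 0 \<omega>))"
    and step_size: "AE \<omega> in M.
          h \<le> min (\<alpha> / (real CARD('j) * (A_max + \<alpha>)^2)) (real CARD('j) / \<alpha>)
                * inverse (ens_energy (z 0 \<omega>))"
  shows "(\<forall>t. x t \<in> borel_measurable M \<and> integrable M (\<lambda>\<omega>. (norm (x t \<omega>))\<^sup>2)) \<and>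
    (\<exists>D\<ge>0. \<forall>\<epsilon>>0. \<forall>T\<ge>1. (\<integral>\<omega>. (norm (x T \<omega>))\<^sup>2 \<partial>M) \<le>
       D * (\<epsilon> + real (\<tau> \<epsilon>) * (1 + ln (real T)) / real T))"
proof -
  define zo where "zo = z_opt A \<alpha> zs"
  define v where "v = zo - zs"
  define b where "b = A_max + \<alpha>"
  define F where "F = natural_filtration M u"
  define noise where "noise t \<omega> = transpose (S (Suc t) \<omega>) *v w (Suc t) \<omega>" for t \<omega>
  define bias where "bias t \<omega> = (gram (S (Suc t) \<omega>) - A) *v v" for t \<omega>
  interpret prob_space M using model by (simp add: observation_model_def)
  have \<Gamma>: "pos_def \<Gamma>"
    and S_meas [measurable]: "S t \<in> borel_measurable M"
    and w_dist: "distributed M lborel (w t) (\<lambda>x. ennreal (mv_normal_density \<Gamma> x))"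
    and indep: "indep_set (sets (extend_sigma (F t) (S (Suc t))))
        (sets (vimage_algebra (space M) (w (Suc t)) borel))" for t
    using model by (auto simp: observation_model_def F_def u_def)
  have w_meas [measurable]: "w t \<in> borel_measurable M" for t
    using distributed_measurable[OF w_dist[of t]] by simp
  have u_meas: "u t \<in> borel_measurable M" for t
    unfolding u_def observation_def[abs_def] by measurable
  have F: "subalgebra M (F t)" for t
    unfolding F_def by (rule subalgebra_natural_filtration[OF u_meas])
  have psdA: "psd A" using ergodic by (simp add: ergodic_data_def loewner_le_def)
  have step: "z (Suc t) \<omega> = deki_step \<alpha> h (S (Suc t) \<omega>) (S (Suc t) \<omega> *v zs + w (Suc t) \<omega>) (z t \<omega>)"
    if "\<omega> \<in> space M" for t \<omega>
    using deki that by (auto simp: is_deki_def u_def observation_def)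
  have zF: "(\<lambda>\<omega>. z t \<omega> j) \<in> borel_measurable (F t)" for t j
    using deki by (simp add: is_deki_def F_def)
  have xF: "x t \<in> borel_measurable (F t)" for t
    unfolding x_def using borel_measurable_ens_mean[OF zF] by measurable
  have x_meas [measurable]: "x t \<in> borel_measurable M" for t
    by (rule measurable_from_subalg[OF F xF])
  have noise_meas [measurable]: "noise t \<in> borel_measurable M" for t
    unfolding noise_def[abs_def] by measurable
  have bias_meas [measurable]: "bias t \<in> borel_measurable M" for t
    unfolding bias_def[abs_def] by measurable
  have all_S: "AE \<omega> in M. \<forall>t. op_norm (gram (S t \<omega>)) \<le> A_max"
    using A_max(2) by (simp add: AE_all_countable)
  define W2 where "W2 = (\<integral>y. mv_normal_density \<Gamma> y * (norm y)\<^sup>2 \<partial>lborel)"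
  note w_moments = mv_normal_moments[OF \<Gamma> w_dist]
  have noise_le: "AE \<omega> in M. (norm (noise t \<omega>))\<^sup>2 \<le> A_max * (norm (w (Suc t) \<omega>))\<^sup>2" for t
    using A_max(2)[of "Suc t"]
  proof eventually_elim
    case (elim \<omega>)
    have "(norm (noise t \<omega>))\<^sup>2 \<le> (sqrt A_max * norm (w (Suc t) \<omega>))\<^sup>2"
      unfolding noise_def using norm_transpose_le[OF elim] A_max(1) by (intro power_mono) auto
    then show ?case using A_max(1) by (simp add: power_mult_distrib)
  qed
  have noise_moment: "integrable M (\<lambda>\<omega>. (norm (noise t \<omega>))\<^sup>2)" for t
  proof (rule Bochner_Integration.integrable_bound)
    show "integrable M (\<lambda>\<omega>. A_max * (norm (w (Suc t) \<omega>))\<^sup>2)"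
      using w_moments(1) by simp
    show "AE \<omega> in M. norm ((norm (noise t \<omega>))\<^sup>2) \<le> norm (A_max * (norm (w (Suc t) \<omega>))\<^sup>2)"
      using noise_le[of t] by eventually_elim simp
  qed measurable
  define \<beta> where "\<beta> = (A_max + op_norm A) * norm v"
  have opA: "0 \<le> op_norm A"
    unfolding op_norm_def by (rule onorm_pos_le[OF matrix_vector_mul_bounded_linear])
  have paths: "AE \<omega> in M. \<omega> \<in> space M \<and>
      riccati_recursion (\<lambda>t y. ens_cov (z t \<omega>) *v y) (\<lambda>t. reg_gram (S (Suc t) \<omega>) \<alpha>) h \<alpha> b"
    using all_S step_size AE_space
  proof eventually_elim
    case (elim \<omega>)
    have "riccati_recursion (\<lambda>t y. ens_cov (z t \<omega>) *v y) (\<lambda>t. reg_gram (S (Suc t) \<omega>) \<alpha>) h \<alpha> b"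
      unfolding b_def
      by (rule deki_pathwise[where z = "\<lambda>t. z t \<omega>" and S = "\<lambda>t. S t \<omega>" and w = "\<lambda>t. w t \<omega>"])
        (use elim step A_max(1) \<alpha> h in auto)
    then show ?case using elim by simp
  qed
  have zo_eq: "(A + mat \<alpha>) *v zo = A *v zs"
    unfolding zo_def by (rule z_opt_unique_minimizer(1)[OF psdA \<alpha>])
  have x_step: "x (Suc t) \<omega> = x t \<omega> - h *\<^sub>R (ens_cov (z t \<omega>) *v
      (reg_gram (S (Suc t) \<omega>) \<alpha> (x t \<omega>) - (noise t \<omega> - bias t \<omega>)))" if "\<omega> \<in> space M" for t \<omega>
    using ens_mean_error_step[OF zo_eq, of h "S (Suc t) \<omega>" "w (Suc t) \<omega>" "z t \<omega>"]
    by (simp add: step[OF that] x_def data_error_def noise_def bias_def v_def zo_def)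
  have b: "\<alpha> < b" using A_max(1) by (simp add: b_def)
  interpret error_process M x noise bias "h * \<alpha>" h "energy_growth h \<alpha> b" "1 / \<sigma>l" "(b + 1) / \<alpha>" "A_max * W2" \<beta>
  proof
    show "x t \<in> borel_measurable M" "noise t \<in> borel_measurable M" "bias t \<in> borel_measurable M" for t
      by measurable
    show "integrable M (\<lambda>\<omega>. (norm (x 0 \<omega>))\<^sup>2)"
    proof (rule Bochner_Integration.integrable_bound)
      let ?m = "\<lambda>\<omega>. 2 * (real CARD('j) * (\<Sum>j\<in>UNIV. (norm (z 0 \<omega> j))\<^sup>2)) + 2 * (norm zo)\<^sup>2"
      show "integrable M ?m"
        by (intro Bochner_Integration.integrable_add integrable_mult_right
            Bochner_Integration.integrable_sum init_moment integrable_const)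
      show "AE \<omega> in M. norm ((norm (x 0 \<omega>))\<^sup>2) \<le> norm (?m \<omega>)"
      proof (intro AE_I2)
        fix \<omega>
        let ?Z = "z 0 \<omega>"
        have "norm (ens_mean ?Z) \<le> norm (\<Sum>j\<in>UNIV. ?Z j)"
        proof -
          have "1 / real CARD('j) \<le> 1" by (simp add: Suc_leI)
          from mult_right_mono[OF this norm_ge_zero[of "\<Sum>j\<in>UNIV. ?Z j"]] show ?thesis
            by (simp add: ens_mean_def)
        qed
        also have "\<dots> \<le> (\<Sum>j\<in>UNIV. norm (?Z j))" by (rule norm_sum)
        finally have "(norm (ens_mean ?Z))\<^sup>2 \<le> (\<Sum>j\<in>UNIV. norm (?Z j))\<^sup>2"
          by (intro power_mono) auto
        also have "\<dots> \<le> real CARD('j) * (\<Sum>j\<in>UNIV. (norm (?Z j))\<^sup>2)"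
          using sum_squared_le_sum_of_squares[of "\<lambda>j. norm (?Z j)" "UNIV :: 'j set"] by (simp add: mult.commute)
        finally have m: "(norm (ens_mean ?Z))\<^sup>2 \<le> real CARD('j) * (\<Sum>j\<in>UNIV. (norm (?Z j))\<^sup>2)" .
        have "(norm (x 0 \<omega>))\<^sup>2 \<le> (norm (ens_mean ?Z) + norm zo)\<^sup>2"
          unfolding x_def zo_def by (intro power_mono norm_triangle_ineq4) auto
        also have "\<dots> \<le> 2 * (norm (ens_mean ?Z))\<^sup>2 + 2 * (norm zo)\<^sup>2"
          using sum_squares_bound[of "norm (ens_mean ?Z)" "norm zo"] by (simp add: power2_sum)
        finally have "(norm (x 0 \<omega>))\<^sup>2 \<le> ?m \<omega>" using m by linarith
        then show "norm ((norm (x 0 \<omega>))\<^sup>2) \<le> norm (?m \<omega>)"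
          by simp
      qed
    qed measurable
    show "integrable M (\<lambda>\<omega>. (norm (noise t \<omega>))\<^sup>2)" for t by (rule noise_moment)
    show "expectation (\<lambda>\<omega>. (norm (noise t \<omega>))\<^sup>2) \<le> A_max * W2" for t
    proof -
      have "expectation (\<lambda>\<omega>. (norm (noise t \<omega>))\<^sup>2) \<le> expectation (\<lambda>\<omega>. A_max * (norm (w (Suc t) \<omega>))\<^sup>2)"
        using w_moments(1) by (intro integral_mono_AE noise_moment noise_le) simp
      then show ?thesis by (simp add: w_moments(2) W2_def)
    qed
    show "AE \<omega> in M. norm (bias t \<omega>) \<le> \<beta>" for t
      using A_max(2)[of "Suc t"]
    proof eventually_elim
      case (elim \<omega>)
      have "norm (bias t \<omega>) \<le> norm (gram (S (Suc t) \<omega>) *v v) + norm (A *v v)"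
        unfolding bias_def matrix_vector_mult_diff_rdistrib by (rule norm_triangle_ineq4)
      also have "\<dots> \<le> A_max * norm v + op_norm A * norm v"
        using A_max(1) by (intro add_mono norm_gram_le[OF elim] op_norm_bound) auto
      finally show ?case by (simp add: \<beta>_def distrib_right)
    qed
    show "AE \<omega> in M. norm (x (Suc t) \<omega> - x t \<omega>) \<le>
      (b + 1) / \<alpha> / (real t + 1) * (norm (x t \<omega>) + norm (noise t \<omega> - bias t \<omega>))" for t
      using paths
    proof eventually_elim
      case (elim \<omega>)
      then interpret riccati_recursion "\<lambda>t y. ens_cov (z t \<omega>) *v y" "\<lambda>t. reg_gram (S (Suc t) \<omega>) \<alpha>" h \<alpha> b
        by blast
      let ?g = "noise t \<omega> - bias t \<omega>"
      have "norm (x (Suc t) \<omega> - x t \<omega>) \<le> (b * norm (x t \<omega>) + norm ?g) / (\<alpha> * (real t + 1))"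
        by (rule increment_bound) (rule x_step, use elim in simp)
      also have "\<dots> \<le> ((b + 1) * (norm (x t \<omega>) + norm ?g)) / (\<alpha> * (real t + 1))"
        using b \<alpha> by (intro divide_right_mono) (auto simp: algebra_simps)
      finally show ?case by simp
    qed
    show "AE \<omega> in M. h * \<alpha> * (real T + 1) * (norm (x T \<omega>))\<^sup>2 \<le> 1 / \<sigma>l * (norm (x 0 \<omega>))\<^sup>2 +
      (\<Sum>t<T. 2 * h * (x t \<omega> \<bullet> (noise t \<omega> - bias t \<omega>)) + energy_growth h \<alpha> b / (real t + 1) *
        (norm (x t \<omega>) * norm (noise t \<omega> - bias t \<omega>) + (norm (noise t \<omega> - bias t \<omega>))\<^sup>2))" for T
      using paths \<sigma>l(2)
    proof eventually_elim
      case (elim \<omega>)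
      then interpret riccati_recursion "\<lambda>t y. ens_cov (z t \<omega>) *v y" "\<lambda>t. reg_gram (S (Suc t) \<omega>) \<alpha>" h \<alpha> b
        by blast
      have "\<sigma>l * (norm y)\<^sup>2 \<le> y \<bullet> (ens_cov (z 0 \<omega>) *v y)" for y
      proof (cases "y = 0")
        case False
        then have "0 < y \<bullet> ((ens_cov (z 0 \<omega>) - mat \<sigma>l) *v y)"
          using elim(2) by (simp add: loewner_less_def pos_def_def)
        then show ?thesis
          by (simp add: matrix_vector_mult_diff_rdistrib mat_mult_vec inner_diff_right power2_norm_eq_inner)
      qed simp
      from energy_bound[OF \<sigma>l(1) this, of "\<lambda>t. x t \<omega>" "\<lambda>t. noise t \<omega> - bias t \<omega>" T] x_step elim(1)
      show ?case by simp
    qed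
    show "0 < h * \<alpha>" "0 \<le> h" "0 \<le> 1 / \<sigma>l" "0 \<le> (b + 1) / \<alpha>" using h \<alpha> \<sigma>l b by auto
    show "0 \<le> energy_growth h \<alpha> b" by (rule energy_growth_nonneg[OF h \<alpha> b])
    show "0 \<le> \<beta>" using A_max(1) opA by (simp add: \<beta>_def)
  qed
  have uncorrelated: "expectation (\<lambda>\<omega>. x t \<omega> \<bullet> noise t \<omega>) = 0" for t
    unfolding noise_def
    by (rule observation_noise_uncorrelated[OF indep subalgebra_extend_sigma[OF S_meas F]
          extend_sigma_mono[OF S_meas F xF] extend_sigma_measurable[OF S_meas F] w_meas
          x_moment w_moments(1) w_moments(3) A_max(2)])
      (use A_max(1) in simp)
  obtain D where D: "0 \<le> D" "\<And>\<epsilon> d T. 0 < \<epsilon> \<Longrightarrow> 1 \<le> d \<Longrightarrow> 1 \<le> T \<Longrightarrow>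
    (\<And>r. 1 \<le> r \<Longrightarrow> \<bar>expectation (\<lambda>\<omega>. x r \<omega> \<bullet> bias (r + d) \<omega>)\<bar> \<le> \<epsilon> * norm v * expectation (\<lambda>\<omega>. norm (x r \<omega>)))
    \<Longrightarrow> msq T \<le> D * (\<epsilon> + real d * (1 + ln (real T)) / real T)"
    using mean_square_rate[OF uncorrelated norm_ge_zero[of v]] by blast
  have "msq T \<le> D * (\<epsilon> + real (\<tau> \<epsilon>) * (1 + ln (real T)) / real T)" if "0 < \<epsilon>" "1 \<le> T" for \<epsilon> T
  proof (rule D(2)[OF that(1) _ that(2)])
    have \<tau>: "0 < \<tau> \<epsilon>"
      and close: "1 \<le> r \<Longrightarrow> AE \<omega> in M. op_norm (matrix_cond_exp M (F r) (\<lambda>\<omega>. gram (S (r + 1 + \<tau> \<epsilon>) \<omega>)) \<omega> - A) \<le> \<epsilon>" for r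
      using ergodic that(1) by (auto simp: ergodic_data_def F_def)
    show "1 \<le> \<tau> \<epsilon>" using \<tau> by simp
    fix r :: nat assume r: "1 \<le> r"
    have "AE \<omega> in M. op_norm (matrix_cond_exp M (F r) (\<lambda>\<omega>. gram (S (Suc (r + \<tau> \<epsilon>)) \<omega>)) \<omega> - A) \<le> \<epsilon>"
      using close[OF r] by simp
    then show "\<bar>expectation (\<lambda>\<omega>. x r \<omega> \<bullet> bias (r + \<tau> \<epsilon>) \<omega>)\<bar> \<le> \<epsilon> * norm v * expectation (\<lambda>\<omega>. norm (x r \<omega>))"
      unfolding bias_def
      by (intro delayed_bias_bound[OF F xF _ x_moment A_max(2)]) measurable
  qed
  with D(1) show ?thesis unfolding msq_def using x_meas x_moment by blast
qed

theorem theorem2p1: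
  fixes M :: "'a measure"
    and S :: "nat \<Rightarrow> 'a \<Rightarrow> real^'d^'p"
    and w :: "nat \<Rightarrow> 'a \<Rightarrow> real^'p"
    and \<Gamma> :: "real^'p^'p"
    and zs :: "real^'d"
    and A :: "real^'d^'d"
    and \<tau> :: "real \<Rightarrow> nat"
    and z :: "nat \<Rightarrow> 'a \<Rightarrow> 'j::finite \<Rightarrow> real^'d"
    and \<alpha> A_max h \<sigma>l q lam :: real
  defines "u \<equiv> observation S zs w"
  defines "\<J> \<equiv> objective A \<alpha> zs"
  assumes model: "observation_model M S zs w \<Gamma>"
    and A_max: "0 < A_max" "\<And>t. AE \<omega> in M. op_norm (gram (S t \<omega>)) \<le> A_max"
    and \<alpha>: "0 < \<alpha>"
    and ergodic: "ergodic_data M (natural_filtration M u) S A \<tau>"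
    and h: "0 < h"
    and deki: "is_deki M \<alpha> (\<lambda>_. h) S u z"
    and init_moment: "\<And>j. integrable M (\<lambda>\<omega>. (norm (z 0 \<omega> j))^2)"
    and \<sigma>l: "0 < \<sigma>l" "AE \<omega> in M. loewner_less (mat \<sigma>l) (ens_cov (z 0 \<omega>))"
    and lam: "q = 2 * \<alpha>" "lam = \<sigma>l * q" "lam \<in> {0<..<1}"
    and step_size: "AE \<omega> in M.
          h \<le> min (\<alpha> / (real CARD('j) * (A_max + \<alpha>)^2)) (real CARD('j) / \<alpha>)
                * inverse (ens_energy (z 0 \<omega>))"
  shows "(\<forall>T. integrable M (\<lambda>\<omega>. \<J> (ens_mean (z T \<omega>)) - \<J> (z_opt A \<alpha> zs))) \<and>
         (\<exists>C. \<forall>\<epsilon>>0. \<forall>T\<ge>1.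
            \<bar>prob_space.expectation M (\<lambda>\<omega>. \<J> (ens_mean (z T \<omega>)) - \<J> (z_opt A \<alpha> zs))\<bar>
              \<le> C * (\<epsilon> + (1 + real (\<tau> \<epsilon>) * (1 + ln (real (\<tau> \<epsilon>)) + ln (real T))) / real T powr lam)) \<and>
         (\<forall>K. \<exists>C. \<forall>T\<ge>2. real (\<tau> (1 / real T)) \<le> K * ln (real T) \<longrightarrow>
            \<bar>prob_space.expectation M (\<lambda>\<omega>. \<J> (ens_mean (z T \<omega>)) - \<J> (z_opt A \<alpha> zs))\<bar>
              \<le> C * ((ln (real T))^2 / real T powr lam))"
proof -
  let ?zo = "z_opt A \<alpha> zs"
  let ?x = "\<lambda>t \<omega>. ens_mean (z t \<omega>) - ?zo"
  let ?gap = "\<lambda>T \<omega>. \<J> (ens_mean (z T \<omega>)) - \<J> ?zo"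
  define m where "m T = (\<integral>\<omega>. (norm (?x T \<omega>))\<^sup>2 \<partial>M)" for T
  define c where "c = op_norm (A + mat \<alpha>) / 2"
  note rate = deki_mean_square_rate[OF model A_max \<alpha> ergodic[unfolded u_def] h deki[unfolded u_def]
      init_moment \<sigma>l step_size]
  have x_meas [measurable]: "?x t \<in> borel_measurable M"
    and x_moment: "integrable M (\<lambda>\<omega>. (norm (?x t \<omega>))\<^sup>2)" for t
    using rate by blast+
  obtain D where D: "0 \<le> D" "\<And>\<epsilon> T. 0 < \<epsilon> \<Longrightarrow> 1 \<le> T \<Longrightarrow>
      m T \<le> D * (\<epsilon> + real (\<tau> \<epsilon>) * (1 + ln (real T)) / real T)"
    using rate unfolding m_def by blast
  have \<tau>: "0 < \<tau> \<epsilon>" if "0 < \<epsilon>" for \<epsilon>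
    using ergodic that by (simp add: ergodic_data_def)
  have psdA: "psd A" using ergodic by (simp add: ergodic_data_def loewner_le_def)
  have c: "0 \<le> c"
    unfolding c_def op_norm_def using onorm_pos_le[OF matrix_vector_mul_bounded_linear] by auto
  have gap: "?gap T \<omega> = 1/2 * (?x T \<omega> \<bullet> ((A + mat \<alpha>) *v ?x T \<omega>))" for T \<omega>
    unfolding \<J>_def by (rule z_opt_unique_minimizer(2)[OF psdA \<alpha>])
  have gap_le: "\<bar>?gap T \<omega>\<bar> \<le> c * (norm (?x T \<omega>))\<^sup>2" for T \<omega>
  proof -
    have "\<bar>?x T \<omega> \<bullet> ((A + mat \<alpha>) *v ?x T \<omega>)\<bar> \<le> norm (?x T \<omega>) * (op_norm (A + mat \<alpha>) * norm (?x T \<omega>))"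
      by (rule order_trans[OF Cauchy_Schwarz_ineq2 mult_left_mono[OF op_norm_bound]]) simp
    then show ?thesis unfolding gap by (simp add: c_def power2_eq_square mult_ac abs_mult)
  qed
  have gap_int: "integrable M (?gap T)" for T
  proof (rule Bochner_Integration.integrable_bound)
    show "integrable M (\<lambda>\<omega>. c * (norm (?x T \<omega>))\<^sup>2)" using x_moment by simp
    show "?gap T \<in> borel_measurable M" unfolding gap by measurable
    show "AE \<omega> in M. norm (?gap T \<omega>) \<le> norm (c * (norm (?x T \<omega>))\<^sup>2)"
      using gap_le c by (intro AE_I2) (simp add: abs_mult)
  qed
  have E_gap: "\<bar>integral\<^sup>L M (?gap T)\<bar> \<le> c * D * (\<epsilon> + real (\<tau> \<epsilon>) * (1 + ln (real T)) / real T)"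
    if "0 < \<epsilon>" "1 \<le> T" for \<epsilon> T
  proof -
    have "\<bar>integral\<^sup>L M (?gap T)\<bar> \<le> (\<integral>\<omega>. \<bar>?gap T \<omega>\<bar> \<partial>M)" by (rule integral_abs_bound)
    also have "\<dots> \<le> (\<integral>\<omega>. c * (norm (?x T \<omega>))\<^sup>2 \<partial>M)"
      using gap_int x_moment by (intro integral_mono gap_le) auto
    also have "\<dots> = c * m T" by (simp add: m_def)
    also have "\<dots> \<le> c * (D * (\<epsilon> + real (\<tau> \<epsilon>) * (1 + ln (real T)) / real T))"
      by (intro mult_left_mono D that c)
    finally show ?thesis by simp
  qed
  have powr_le: "1 / real T \<le> 1 / real T powr lam" if "1 \<le> T" for T
  proof -
    have "real T powr lam \<le> real T powr 1" using that lam(3) by (intro powr_mono) auto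
    then show ?thesis using that by (intro divide_left_mono) auto
  qed
  have first: "\<bar>integral\<^sup>L M (?gap T)\<bar> \<le>
      c * D * (\<epsilon> + (1 + real (\<tau> \<epsilon>) * (1 + ln (real (\<tau> \<epsilon>)) + ln (real T))) / real T powr lam)"
    if "0 < \<epsilon>" "1 \<le> T" for \<epsilon> T
  proof (rule order_trans[OF E_gap[OF that] mult_left_mono])
    have ln: "0 \<le> ln (real T)" "0 \<le> ln (real (\<tau> \<epsilon>))" using that \<tau>[OF that(1)] by auto
    have "real (\<tau> \<epsilon>) * (1 + ln (real T)) * (1 / real T) \<le>
        (1 + real (\<tau> \<epsilon>) * (1 + ln (real (\<tau> \<epsilon>)) + ln (real T))) * (1 / real T powr lam)"
    proof (rule mult_mono[OF _ powr_le[OF that(2)]])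
      have "real (\<tau> \<epsilon>) * (1 + ln (real T)) \<le> real (\<tau> \<epsilon>) * (1 + ln (real (\<tau> \<epsilon>)) + ln (real T))"
        using ln by (intro mult_left_mono) auto
      then show "real (\<tau> \<epsilon>) * (1 + ln (real T)) \<le> 1 + real (\<tau> \<epsilon>) * (1 + ln (real (\<tau> \<epsilon>)) + ln (real T))"
        by linarith
      show "0 \<le> 1 + real (\<tau> \<epsilon>) * (1 + ln (real (\<tau> \<epsilon>)) + ln (real T))" using ln by simp
    qed simp
    then show "\<epsilon> + real (\<tau> \<epsilon>) * (1 + ln (real T)) / real T \<le>
        \<epsilon> + (1 + real (\<tau> \<epsilon>) * (1 + ln (real (\<tau> \<epsilon>)) + ln (real T))) / real T powr lam"
      by simp
  qed (use c D(1) in simp)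
  have second: "\<bar>integral\<^sup>L M (?gap T)\<bar> \<le>
      c * D * (1 / (ln 2)\<^sup>2 + \<bar>K\<bar> * (1 / ln 2 + 1)) * ((ln (real T))\<^sup>2 / real T powr lam)"
    if T: "2 \<le> T" and K: "real (\<tau> (1 / real T)) \<le> K * ln (real T)" for K T
  proof -
    define l where "l = ln (real T)"
    have l2: "0 < ln (2::real)" "ln 2 \<le> l" using T by (auto simp: l_def)
    then have l: "0 < l" by linarith
    \<comment> \<open>Since \<open>T \<ge> 2\<close>, constants are absorbed into powers of the logarithm.\<close>
    have "1 \<le> l / ln 2" using l2 by simp
    then have e1: "1 \<le> (l / ln 2)\<^sup>2" by (simp add: one_le_power)
    have "1 + l \<le> l / ln 2 + l" using \<open>1 \<le> l / ln 2\<close> by simp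
    then have e2: "1 + l \<le> (1 / ln 2 + 1) * l" by (simp add: distrib_right)
    have "real (\<tau> (1 / real T)) \<le> \<bar>K\<bar> * l"
      using K l by (smt (verit) l_def mult_right_mono abs_ge_self)
    then have "real (\<tau> (1 / real T)) * (1 + l) \<le> (\<bar>K\<bar> * l) * ((1 / ln 2 + 1) * l)"
      using e2 l by (intro mult_mono) auto
    then have "1 + real (\<tau> (1 / real T)) * (1 + l) \<le> (l / ln 2)\<^sup>2 + (\<bar>K\<bar> * l) * ((1 / ln 2 + 1) * l)"
      using e1 by linarith
    also have "\<dots> = (1 / (ln 2)\<^sup>2 + \<bar>K\<bar> * (1 / ln 2 + 1)) * l\<^sup>2"
      by (simp add: power2_eq_square algebra_simps)
    finally have "(1 + real (\<tau> (1 / real T)) * (1 + l)) * (1 / real T) \<le>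
        ((1 / (ln 2)\<^sup>2 + \<bar>K\<bar> * (1 / ln 2 + 1)) * l\<^sup>2) * (1 / real T powr lam)"
      using T l2 by (intro mult_mono powr_le) auto
    then have "c * D * (1 / real T + real (\<tau> (1 / real T)) * (1 + l) / real T) \<le>
        c * D * (((1 / (ln 2)\<^sup>2 + \<bar>K\<bar> * (1 / ln 2 + 1)) * l\<^sup>2) * (1 / real T powr lam))"
      using c D(1) by (intro mult_left_mono) (auto simp: add_divide_distrib)
    with E_gap[of "1 / real T" T] T show ?thesis by (simp add: l_def mult.assoc)
  qed
  show ?thesis
    using gap_int first second by blast
qed

end
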